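(* Fix $0<\sigma\le\sigma_F$ and $\varepsilon>0$. Then there is $L=L(\sigma,\varepsilon)>0$ such that every interval of length $L$ in $\mathbb R$ contains the ordinate $\operatorname{Im}\rho$ of a zero $\rho$ of $Z_F$ satisfying $|\operatorname{Re}\rho-\sigma|<\varepsilon$. For $\sigma=\sigma_F$ these zeros necessarily satisfy $\sigma_F-\varepsilon<\operatorname{Re}\rho<\sigma_F$. Consequently, if $$N_{\sigma,\varepsilon}(T)=\#\{\rho: Z_F(\rho)=0,\ 0<\operatorname{Im}\rho\le T,\ |\operatorname{Re}\rho-\sigma|<\varepsilon\},$$ with zeros counted with multiplicity, then $N_{\sigma,\varepsilon}(T)\gg_{\sigma,\varepsilon}T$ (as $T\to\infty$).
   Context: $F_1=F_2=1$, $F_{n+2}=F_{n+1}+F_n$ are the Fibonacci numbers, and $Z_F(s)=\sum_{n\ge1}F_n^{-s}$ for $\operatorname{Re}s>0$; zeros of $Z_F$ are taken in $\operatorname{Re}s>0$. $\sigma_F=0.7431\ldots$ is the unique number in $(0.7,0.75)$ with $Z_F(\sigma_F)=4+2\cdot144^{-\sigma_F}$. The notation $f(T)\gg_{\sigma,\varepsilon}T$ means $f(T)\ge cT$ for all sufficiently large $T$, with a constant $c>0$ depending only on $\sigma,\varepsilon$. *)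

theory Defs
  imports "HOL-Complex_Analysis.Complex_Analysis" "HOL-Number_Theory.Fib"
begin

text \<open>The series runs over indices \<open>n \<ge> 1\<close>, whence the shift. It converges for \<open>Re s > 0\<close> only;
  the value of \<open>suminf\<close> elsewhere is meaningless and is never used.\<close>

definition fib_zeta :: "complex \<Rightarrow> complex" where
  "fib_zeta s = (\<Sum>n. of_nat (fib (Suc n)) powr (- s))"

definition fib_zeta_zeros :: "complex set" where
  "fib_zeta_zeros = {\<rho>. 0 < Re \<rho> \<and> fib_zeta \<rho> = 0}"

definition sigma_F :: real where
  "sigma_F = (THE x. x \<in> {0.7<..<0.75} \<and>
     fib_zeta (of_real x) = of_real (4 + 2 * 144 powr (- x)))"

text \<open>The count is taken in \<^typ>\<open>ennreal\<close>, so that it is the true number of zeros with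
  multiplicity without presupposing that the set is finite (for \<open>\<epsilon> > \<sigma>\<close> the region reaches
  up to the imaginary axis).\<close>

definition zero_count :: "real \<Rightarrow> real \<Rightarrow> real \<Rightarrow> ennreal" where
  "zero_count \<sigma> \<epsilon> T =
     (\<Sum>\<^sub>\<infinity>\<rho>\<in>{\<rho> \<in> fib_zeta_zeros. 0 < Im \<rho> \<and> Im \<rho> \<le> T \<and> \<bar>Re \<rho> - \<sigma>\<bar> < \<epsilon>}.
        of_nat (nat (zorder fib_zeta \<rho>)))"

end

theory Submission
  imports Defs "HOL-Number_Theory.Number_Theory"
begin

text \<open>
  On a vertical line \<open>Re s = \<sigma>\<close> the phases \<open>F\<^sub>n\<close> to the power \<open>-it\<close>, \<open>n \<ge> 3\<close>, \<open>n \<noteq> 6, 12\<close>, are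
  independent: by Carmichael's theorem each such \<open>F\<^sub>n\<close> has a prime factor dividing no earlier
  Fibonacci number, so the \<open>ln F\<^sub>n\<close> are linearly independent over the integers and Kronecker's theorem
  applies. The two exceptional phases are forced by \<open>F\<^sub>6 = F\<^sub>3\<^sup>3\<close> and \<open>F\<^sub>1\<^sub>2 = F\<^sub>3\<^sup>4 F\<^sub>4\<^sup>2\<close>. With all
  free phases equal to \<open>-1\<close> the series on the line is \<open>2 + 144\<close> to the power \<open>-\<sigma>\<close> minus the sum of
  the other terms, which vanishes exactly at \<open>\<sigma>\<^sub>F\<close>. For \<open>\<sigma> \<le> \<sigma>\<^sub>F\<close> the remaining terms are large enough
  for a suitable choice of signs to give a twisted series with a zero at \<open>\<sigma>\<close>; vertical shifts by a
  relatively dense set of \<open>t\<close> approximate the twisted series uniformly near \<open>\<sigma>\<close>, so they have a zero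
  there as well. For \<open>Re s \<ge> \<sigma>\<^sub>F\<close> the real part is nonnegative, and it can vanish only if
  both \<open>2\<close> and \<open>3\<close> have phase \<open>-1\<close>, which the independence of \<open>ln 2\<close> and \<open>ln 3\<close> excludes.
\<close>

section \<open>Carmichael's theorem on primitive prime divisors\<close>

text \<open>Primitive primes come from a comparison of sizes: the product of F_(n/d)^mu(d) over the
  divisors d of n has size about golden^phi(n), whereas without a primitive prime it could not
  exceed 2n. The two collide from n = 66 on; below that, explicit divisors of F_n serve as
  certificates. The indices 6 and 12 shape the rest. In the choice of signs they are holes in the
  sequence of free terms, so the condition that each term be at most the sum of the later ones has
  to survive these holes. In the zero-free half-plane the term of 144 defeats a termwise comparison:
  the extremal pattern gives it the sign +1, so moving its phase lowers the real part. That loss is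
  bounded by gains at 2, 3 and 8, because the phase of 144 is a monomial in those of 2 and 3. The
  same term enters the equation for \<open>sigma_F\<close> as -144^(-x), which spoils termwise
  monotonicity in x; it is absorbed by 2^(-x) + 3^(-x).\<close>

lemma fib_dvd_mono: "m dvd n \<Longrightarrow> fib m dvd fib n"
  by (metis fib_gcd gcd_nat.absorb1 gcd_dvd2)

section \<open>Valuations of F_(km) relative to F_m\<close>

lemma cong_add_multI:
  fixes a b c m :: int
  shows "a = b + m * c \<Longrightarrow> [a = b] (mod m)"
  by (simp add: cong_def)

text \<open>Advancing the sequence by \<open>m\<close> steps is the matrix with rows
  (\<open>z\<close>, \<open>x\<close>) and (\<open>x\<close>, \<open>z - x\<close>), that is,
  \<open>z\<close> times the identity plus \<open>x\<close> times a fixed matrix. The formulas are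
  the start of the binomial expansion of its \<open>k\<close>-th power in powers of
  \<open>x\<close>. The factor \<open>z\<^sup>2\<close> avoids negative exponents for small
  \<open>k\<close>.\<close>

lemma fib_mult_expansion:
  fixes m k :: nat
  assumes "m > 0"
  defines "x \<equiv> int (fib m)" and "z \<equiv> int (fib (Suc m))"
  shows "\<exists>a. int (fib (k * m)) = x * a \<and>
     [z\<^sup>2 * a = int k * z ^ Suc k - int (k choose 2) * x * z ^ k] (mod x\<^sup>2) \<and>
     [int (fib (Suc (k * m))) = z ^ k] (mod x\<^sup>2)"
proof (induction k)
  case 0
  show ?case by (intro exI[of _ 0]) (simp add: numeral_2_eq_2)
next
  case (Suc k)
  obtain j where j: "m = Suc j" using assms(1) gr0_implies_Suc by blast
  define y where "y = int (fib j)"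
  have z: "z = x + y" by (simp add: z_def x_def y_def j)
  obtain a where a: "int (fib (k * m)) = x * a"
     "[z\<^sup>2 * a = int k * z ^ Suc k - int (k choose 2) * x * z ^ k] (mod x\<^sup>2)"
     "[int (fib (Suc (k * m))) = z ^ k] (mod x\<^sup>2)" using Suc by blast
  define c where "c = int (fib (Suc (k * m)))"
  have A: "int (fib (Suc k * m)) = x * (c + y * a)"
  proof -
    have "Suc k * m = Suc (k * m + j)" by (simp add: j)
    hence "fib (Suc k * m) = fib (Suc (k * m + j))" by (rule arg_cong)
    also have "\<dots> = fib m * fib (Suc (k*m)) + fib j * fib (k*m)" by (simp add: fib_add j)
    finally show ?thesis by (simp add: a(1) c_def x_def y_def algebra_simps)
  qed
  have C: "int (fib (Suc (Suc k * m))) = z * c + x * x * a"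
  proof -
    have "fib (Suc (Suc k * m)) = fib (Suc (k * m + m))" by (simp add: add.commute)
    also have "\<dots> = fib (Suc m) * fib (Suc (k*m)) + fib m * fib (k*m)" by (simp add: fib_add)
    finally show ?thesis by (simp add: a(1) c_def x_def z_def algebra_simps)
  qed
  obtain u where u: "z\<^sup>2 * a = int k * z ^ Suc k - int (k choose 2) * x * z ^ k + x\<^sup>2 * u"
    using a(2) by (metis cong_iff_lin cong_sym)
  obtain v where v: "c = z ^ k + x\<^sup>2 * v"
    using a(3) unfolding c_def by (metis cong_iff_lin cong_sym)
  have ch: "int (Suc k choose 2) = int (k choose 2) + int k"
    by (simp add: numeral_2_eq_2)
  have "z\<^sup>2 * (c + y * a) = z^2 * (z ^ k + x\<^sup>2 * v) + (z - x) * (z\<^sup>2 * a)"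
    unfolding v z by (simp add: algebra_simps)
  also have "\<dots> = int (Suc k) * z ^ Suc (Suc k) - int (Suc k choose 2) * x * z ^ Suc k
        + x\<^sup>2 * (z^2 * v + (z - x) * u + int (k choose 2) * z ^ k)"
    unfolding u ch by (simp add: algebra_simps power2_eq_square)
  finally have 1: "[z\<^sup>2 * (c + y * a) = int (Suc k) * z ^ Suc (Suc k) - int (Suc k choose 2) * x * z ^ Suc k] (mod x\<^sup>2)"
    by (rule cong_add_multI)
  have "z * c + x * x * a = z ^ Suc k + x\<^sup>2 * (z * v + a)"
    unfolding v by (simp add: algebra_simps power2_eq_square)
  hence "[int (fib (Suc (Suc k * m))) = z ^ Suc k] (mod x\<^sup>2)"
    unfolding C by (rule cong_add_multI)
  with 1 A show ?case by blast
qed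

text \<open>The sum is the Lucas number of index n + 1, which is the quotient F_(2m)/F_m for m = n +
  1. The set \<open>R\<close> is the complete cycle, of period 12, of consecutive Fibonacci pairs
  modulo 8.\<close>

lemma not_8_dvd_fib_add_fib:
  "\<not> 8 dvd fib n + fib (Suc (Suc n))"
proof -
  define R where "R = {(0::nat,1),(1,1),(1,2),(2,3),(3,5),(5,0),(0,5),(5,5),(5,2),(2,7),(7,1),(1,0::nat)}"
  have step: "(b, (b + a) mod 8) \<in> R" if "(a, b) \<in> R" for a b
    using that unfolding R_def by (simp, elim disjE; simp)
  have "(fib n mod 8, fib (Suc n) mod 8) \<in> R"
  proof (induction n)
    case (Suc n)
    have "fib (Suc (Suc n)) mod 8 = (fib (Suc n) mod 8 + fib n mod 8) mod 8"
      by (simp add: mod_simps)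
    with step[OF Suc] show ?case by metis
  qed (simp add: R_def)
  moreover have "(2 * a + b) mod 8 \<noteq> 0" if "(a, b) \<in> R" for a b
    using that unfolding R_def by (simp, elim disjE; simp)
  ultimately have "(2 * (fib n mod 8) + fib (Suc n) mod 8) mod 8 \<noteq> 0" by blast
  hence "(2 * fib n + fib (Suc n)) mod 8 \<noteq> 0" by (metis mod_add_left_eq mod_mult_right_eq mod_add_right_eq)
  thus ?thesis by (simp add: dvd_eq_mod_eq_0 mult_2 add_ac)
qed

text \<open>The quotient \<open>a\<close> of F_(km) by F_m satisfies z^2 a = k z^(k+1) modulo
  \<open>p\<close>, with \<open>z\<close> prime to \<open>p\<close>; for k = q different from
  \<open>p\<close> it is therefore prime to \<open>p\<close>. For k = p odd, C(p,2) x is divisible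
  by p^2, so the same congruence holds modulo p^2 and \<open>a\<close> contains \<open>p\<close> at
  most once. For p = 2 the binomial coefficient is 1 and this fails; there the quotient is a Lucas
  number, which is never divisible by 8.\<close>

lemma multiplicity_fib_mult_prime:
  fixes p q m :: nat
  assumes p: "prime p" and q: "prime q" and m: "m > 0" and dvd: "p dvd fib m"
  shows "p \<noteq> q \<Longrightarrow> multiplicity p (fib (q * m)) = multiplicity p (fib m)"
    and "multiplicity p (fib (p * m)) \<le> multiplicity p (fib m) + (if p = 2 then 2 else 1)"
proof -
  define x z where "x = int (fib m)" and "z = int (fib (Suc m))"
  have px: "int p dvd x" using dvd by (simp add: x_def)
  have pz: "\<not> int p dvd z"
  proof
    assume "int p dvd z"
    hence "p dvd fib (Suc m)" by (simp add: z_def)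
    with dvd have "p dvd 1" using coprime_fib_Suc_nat[of m] coprime_common_divisor by metis
    thus False using p by (metis not_prime_unit)
  qed
  have pz': "\<not> int p dvd z ^ k" for k
    using pz p by (meson prime_dvd_power prime_nat_int_transfer)
  have fm: "fib m \<noteq> 0" using m fib_neq_0_nat by force
  have main: "\<exists>a::nat. fib (k * m) = fib m * a \<and> a \<noteq> 0 \<and>
     [z\<^sup>2 * int a = int k * z ^ Suc k - int (k choose 2) * x * z ^ k] (mod x\<^sup>2)" if "k > 0" for k
  proof -
    obtain a where a: "int (fib (k * m)) = x * a"
     "[z\<^sup>2 * a = int k * z ^ Suc k - int (k choose 2) * x * z ^ k] (mod x\<^sup>2)"
      using fib_mult_expansion[OF m, of k] unfolding x_def z_def by blast
    have "fib (k * m) > 0" using m that by (simp add: fib_neq_0_nat)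
    hence "a > 0" using a(1) fm
      by (metis of_nat_0_le_iff of_nat_0_less_iff x_def zero_less_mult_pos2 zero_less_mult_iff order_less_le_trans linorder_not_less)
    then obtain b where b: "a = int b" "b > 0" by (metis zero_less_imp_eq_int)
    have "fib (k * m) = fib m * b" using a(1) unfolding b x_def by (metis of_nat_mult of_nat_eq_iff)
    thus ?thesis using a b by auto
  qed
  { assume "p \<noteq> q"
    obtain a where a: "fib (q * m) = fib m * a" "a \<noteq> 0"
       "[z\<^sup>2 * int a = int q * z ^ Suc q - int (q choose 2) * x * z ^ q] (mod x\<^sup>2)"
      using main[of q] q prime_gt_0_nat by blast
    have "\<not> p dvd a"
    proof
      assume "p dvd a"
      hence 1: "int p dvd z\<^sup>2 * int a" by simp
      have "int p dvd x\<^sup>2" using px by (simp add: power2_eq_square)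
      hence "int p dvd z\<^sup>2 * int a - (int q * z ^ Suc q - int (q choose 2) * x * z ^ q)"
        using a(3) by (meson cong_iff_dvd_diff dvd_trans)
      hence "int p dvd (int q * z ^ Suc q - int (q choose 2) * x * z ^ q)"
        using dvd_diff_right_iff[OF 1] by blast
      hence "int p dvd int q * z ^ Suc q"
        using dvd_diff_left_iff[OF dvd_mult2[OF dvd_mult[OF px]]] by blast
      hence "int p dvd int q" using pz' p
        by (metis prime_dvd_multD prime_nat_int_transfer)
      thus False using p q \<open>p \<noteq> q\<close> primes_dvd_imp_eq by auto
    qed
    hence "multiplicity p a = 0" by (simp add: not_dvd_imp_multiplicity_0)
    thus "multiplicity p (fib (q * m)) = multiplicity p (fib m)"
      using a fm p by (simp add: prime_elem_multiplicity_mult_distrib)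
  }
  show "multiplicity p (fib (p * m)) \<le> multiplicity p (fib m) + (if p = 2 then 2 else 1)"
  proof (cases "p = 2")
    case True
    obtain j where j: "m = Suc j" using m gr0_implies_Suc by blast
    have "p * m = Suc (m + j)" by (simp add: True j)
    hence "fib (p * m) = fib (Suc (m + j))" by (rule arg_cong)
    also have "\<dots> = fib (Suc j) * fib (Suc m) + fib j * fib m" by (rule fib_add)
    also have "\<dots> = fib m * (fib j + fib (Suc (Suc j)))" unfolding j by (simp only: mult.commute distrib_left add.commute)
    finally have eq: "fib (p * m) = fib m * (fib j + fib (Suc (Suc j)))" .
    have "\<not> p ^ 3 dvd fib j + fib (Suc (Suc j))"
      using not_8_dvd_fib_add_fib[of j] unfolding True by (simp del: fib.simps)
    hence "multiplicity p (fib j + fib (Suc (Suc j))) < 3"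
      by (meson multiplicity_dvd' not_less)
    moreover have "fib j + fib (Suc (Suc j)) \<noteq> 0" using fib_neq_0_nat[of "Suc (Suc j)"] by linarith
    hence "multiplicity p (fib (p * m)) = multiplicity p (fib m) + multiplicity p (fib j + fib (Suc (Suc j)))"
      unfolding eq using fm p by (intro prime_elem_multiplicity_mult_distrib prime_imp_prime_elem)
    ultimately show ?thesis using True by simp
  next
    case False
    obtain a where a: "fib (p * m) = fib m * a" "a \<noteq> 0"
       "[z\<^sup>2 * int a = int p * z ^ Suc p - int (p choose 2) * x * z ^ p] (mod x\<^sup>2)"
      using main[of p] p prime_gt_0_nat by blast
    have p2: "p > 2" using False p prime_ge_2_nat[of p] by linarith
    have "2 * (p choose 2) = p * (p - 1)"
      using p2 by (simp add: choose_two)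
    hence "p dvd 2 * (p choose 2)" by (metis dvd_triv_left)
    hence "p dvd (p choose 2)"
      using p p2 by (metis dvd_imp_le not_less prime_dvd_multD zero_less_numeral)
    have "\<not> p\<^sup>2 dvd a"
    proof
      assume "p\<^sup>2 dvd a"
      hence 1: "(int p)\<^sup>2 dvd z\<^sup>2 * int a" by (metis dvd_mult of_nat_dvd_iff of_nat_power)
      have "(int p)\<^sup>2 dvd x\<^sup>2" using px by simp
      hence "(int p)\<^sup>2 dvd z\<^sup>2 * int a - (int p * z ^ Suc p - int (p choose 2) * x * z ^ p)"
        using a(3) by (meson cong_iff_dvd_diff dvd_trans)
      hence 2: "(int p)\<^sup>2 dvd (int p * z ^ Suc p - int (p choose 2) * x * z ^ p)"
        using dvd_diff_right_iff[OF 1] by blast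
      have "(int p)\<^sup>2 dvd int (p choose 2) * x"
        unfolding power2_eq_square using \<open>p dvd (p choose 2)\<close> px by (intro mult_dvd_mono) simp_all
      hence "(int p)\<^sup>2 dvd int (p choose 2) * x * z ^ p" by (rule dvd_mult2)
      hence "(int p)\<^sup>2 dvd int p * z ^ Suc p"
        using 2 dvd_diff_left_iff by blast
      hence "int p dvd z ^ Suc p" using p2 by (simp add: power2_eq_square)
      thus False using pz' by blast
    qed
    hence "multiplicity p a < 2" by (meson multiplicity_dvd' not_less)
    moreover have "multiplicity p (fib (p * m)) = multiplicity p (fib m) + multiplicity p a"
      unfolding a(1) using a(2) fm p by (intro prime_elem_multiplicity_mult_distrib prime_imp_prime_elem)
    ultimately show ?thesis using False by simp
  qed
qed

text \<open>This is the sum of \<open>\<mu>(d) f(n/d)\<close> over the divisors \<open>d\<close> of \<open>n\<close>, written over the squarefree ones only.\<close>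

definition prime_subset_sum :: "nat \<Rightarrow> (nat \<Rightarrow> real) \<Rightarrow> real" where
  "prime_subset_sum n f = (\<Sum>S\<in>Pow (prime_factors n). (- 1) ^ card S * f (n div \<Prod>S))"

text \<open>Pairing each subset that avoids \<open>q\<close> with the one obtained by adjoining
  \<open>q\<close> yields differences of \<open>f\<close> at arguments with ratio \<open>q\<close>.
  Whenever \<open>f\<close> does not notice a factor \<open>q\<close>, everything cancels.\<close>

lemma prime_subset_sum_remove:
  assumes "q \<in> prime_factors n"
  shows "prime_subset_sum n f = (\<Sum>S\<in>Pow (prime_factors n - {q}).
           (- 1) ^ card S * (f (n div \<Prod>S) - f (n div (q * \<Prod>S))))"
proof -
  define P where "P = prime_factors n - {q}"
  have P: "prime_factors n = insert q P" "finite P" "q \<notin> P" using assms by (auto simp: P_def)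
  have fin: "finite S" if "S \<in> Pow P" for S using that P finite_subset by blast
  have "prime_subset_sum n f = (\<Sum>S\<in>Pow P. (- 1) ^ card S * f (n div \<Prod>S))
      + (\<Sum>S\<in>insert q ` Pow P. (- 1) ^ card S * f (n div \<Prod>S))"
    unfolding prime_subset_sum_def P(1) Pow_insert using P by (intro sum.union_disjoint) auto
  also have "(\<Sum>S\<in>insert q ` Pow P. (- 1) ^ card S * f (n div \<Prod>S))
     = (\<Sum>S\<in>Pow P. (- 1) ^ card (insert q S) * f (n div \<Prod>(insert q S)))"
    using P by (subst sum.reindex) (auto simp: inj_on_def)
  also have "\<dots> = (\<Sum>S\<in>Pow P. - ((- 1) ^ card S * f (n div (q * \<Prod>S))))"
  proof (rule sum.cong[OF refl])
    fix S assume S: "S \<in> Pow P"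
    hence "q \<notin> S" "finite S" using P fin by auto
    thus "(- 1) ^ card (insert q S) * f (n div \<Prod>(insert q S)) = - ((- 1) ^ card S * f (n div (q * \<Prod>S)))"
      by simp
  qed
  finally show ?thesis
    unfolding P_def[symmetric] by (simp add: sum_negf sum_subtractf right_diff_distrib)
qed

lemma prod_prime_subset:
  assumes "S \<subseteq> prime_factors (n::nat)" "n > 0"
  shows "\<Prod>S dvd n" "\<Prod>S > 0"
proof -
  have fin: "finite S" using assms finite_subset by blast
  have "\<Prod>S dvd n" if "finite S" "S \<subseteq> prime_factors n" for S
    using that
  proof (induction S rule: finite_induct)
    case (insert q S)
    have "coprime q (\<Prod>S)"
      using insert by (intro prod_coprime_right) (auto simp: in_prime_factors_iff subset_iff intro!: primes_coprime)
    moreover have "q dvd n" "\<Prod>S dvd n" using insert by auto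
    ultimately show ?case using insert by (simp add: divides_mult)
  qed simp
  from this[OF fin assms(1)] show "\<Prod>S dvd n" .
  show "\<Prod>S > 0" using assms by (intro prod_pos) (auto simp: in_prime_factors_iff subset_iff prime_gt_0_nat)
qed

lemma prime_subset_sum_const:
  assumes "n > 1"
  shows "prime_subset_sum n (\<lambda>_. c) = 0"
proof -
  obtain q where "prime q" "q dvd n" using assms prime_factor_nat[of n] by auto
  hence "q \<in> prime_factors n" using assms by (auto simp: in_prime_factors_iff)
  thus ?thesis by (subst prime_subset_sum_remove) auto
qed

lemma prime_subset_sum_real:
  assumes "n > 0"
  shows "prime_subset_sum n real = totient n"
proof -
  have "real (totient n) = real n * (\<Prod>p\<in>prime_factors n. 1 - 1 / real p)" by (rule totient_formula2)
  also have "(\<Prod>p\<in>prime_factors n. 1 - 1 / real p) =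
     (\<Sum>X\<in>Pow (prime_factors n). (-1) ^ card X * (\<Prod>x\<in>X. 1 / real x) * (\<Prod>x\<in>prime_factors n - X. 1))"
    by (rule prod_diff_conv_sum) simp
  also have "real n * \<dots> = prime_subset_sum n real"
    unfolding prime_subset_sum_def sum_distrib_left
  proof (rule sum.cong[OF refl])
    fix X assume "X \<in> Pow (prime_factors n)"
    hence "\<Prod>X dvd n" "\<Prod>X > 0" using prod_prime_subset[of X n] assms by auto
    thus "real n * ((- 1) ^ card X * (\<Prod>x\<in>X. 1 / real x) * (\<Prod>x\<in>prime_factors n - X. 1)) = (- 1) ^ card X * real (n div \<Prod>X)"
      by (simp add: real_of_nat_div prod_dividef)
  qed
  finally show ?thesis by simp
qed

lemma prime_subset_sum_add:
  "prime_subset_sum n (\<lambda>m. f m + g m) = prime_subset_sum n f + prime_subset_sum n g"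
  unfolding prime_subset_sum_def by (simp add: distrib_left sum.distrib)

lemma prime_subset_sum_cmult:
  "prime_subset_sum n (\<lambda>m. c * f m) = c * prime_subset_sum n f"
  unfolding prime_subset_sum_def by (simp add: sum_distrib_left mult_ac)

lemma prime_subset_sum_sum:
  "prime_subset_sum n (\<lambda>m. \<Sum>i\<in>I. f i m) = (\<Sum>i\<in>I. prime_subset_sum n (f i))"
  unfolding prime_subset_sum_def sum_distrib_left by (rule sum.swap)

lemma prime_subset_sum_cong:
  assumes "\<And>m. m dvd n \<Longrightarrow> m > 0 \<Longrightarrow> f m = g m" "n > 0"
  shows "prime_subset_sum n f = prime_subset_sum n g"
  unfolding prime_subset_sum_def
proof (rule sum.cong[OF refl])
  fix X assume "X \<in> Pow (prime_factors n)"
  hence "\<Prod>X dvd n" "\<Prod>X > 0" using prod_prime_subset[of X n] assms by auto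
  hence "n div \<Prod>X dvd n" "n div \<Prod>X > 0" using assms(2) by (auto elim!: dvdE)
  thus "(- 1) ^ card X * f (n div \<Prod>X) = (- 1) ^ card X * g (n div \<Prod>X)" using assms(1) by simp
qed

text \<open>Different sets of primes have different products, so the arguments
  \<open>n div \<Prod>S\<close> are distinct numbers between 1 and \<open>n\<close> and no value of
  \<open>f\<close> is counted twice.\<close>

lemma abs_prime_subset_sum_le:
  assumes "n > 0"
  shows "\<bar>prime_subset_sum n f\<bar> \<le> (\<Sum>m=1..n. \<bar>f m\<bar>)"
proof -
  have inj: "inj_on (\<lambda>S. n div \<Prod>S) (Pow (prime_factors n))"
  proof (rule inj_onI)
    fix S T assume S: "S \<in> Pow (prime_factors n)" and T: "T \<in> Pow (prime_factors n)"
      and eq: "n div \<Prod>S = n div \<Prod>T"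
    have "\<Prod>S dvd n" "\<Prod>S > 0" "\<Prod>T dvd n" "\<Prod>T > 0"
      using prod_prime_subset[of S n] prod_prime_subset[of T n] S T assms by auto
    hence "\<Prod>S = \<Prod>T" using eq assms by (metis dvd_div_eq_iff nat_less_le dvd_div_mult_self mult_cancel_left div_0 dvd_div_eq_0_iff)
    have pf: "prime_factors (\<Prod>S) = S" if "S \<subseteq> prime_factors n" for S :: "nat set"
    proof -
      have "finite S" using that finite_subset by blast
      moreover have "\<And>p. p \<in> S \<Longrightarrow> prime p" using that by (auto simp: in_prime_factors_iff)
      ultimately show ?thesis
        by (subst prime_factors_prod) (auto simp: prime_factorization_prime in_prime_factors_iff dest: \<open>\<And>p. p \<in> S \<Longrightarrow> prime p\<close>)
    qed
    have "S \<subseteq> prime_factors n" "T \<subseteq> prime_factors n" using S T by blast+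
    thus "S = T" using pf \<open>\<Prod>S = \<Prod>T\<close> by metis
  qed
  have "\<bar>prime_subset_sum n f\<bar> \<le> (\<Sum>S\<in>Pow (prime_factors n). \<bar>f (n div \<Prod>S)\<bar>)"
    unfolding prime_subset_sum_def by (rule order_trans[OF sum_abs]) (simp add: abs_mult power_abs)
  also have "\<dots> = (\<Sum>m\<in>(\<lambda>S. n div \<Prod>S) ` Pow (prime_factors n). \<bar>f m\<bar>)"
    unfolding sum.reindex[OF inj] by (simp only: o_def)
  also have "\<dots> \<le> (\<Sum>m=1..n. \<bar>f m\<bar>)"
  proof (intro sum_mono2)
    show "(\<lambda>S. n div \<Prod>S) ` Pow (prime_factors n) \<subseteq> {1..n}"
    proof safe
      fix X assume "X \<subseteq> prime_factors n"
      hence "\<Prod>X dvd n" "\<Prod>X > 0" using prod_prime_subset[of X n] assms by auto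
      thus "n div \<Prod>X \<in> {1..n}" using assms by (auto elim!: dvdE)
    qed
  qed auto
  finally show ?thesis .
qed

lemma prime_dvd_fib_gcd: "prime p \<Longrightarrow> p dvd fib a \<Longrightarrow> p dvd fib b \<Longrightarrow> p dvd fib (gcd a b)" for p :: nat
  by (simp add: fib_gcd)

lemma fib_proper_divisor_dvd:
  fixes p n m :: nat
  assumes "prime p" "p dvd fib n" "p dvd fib m" "0 < m" "m < n"
  shows "\<exists>q. prime q \<and> q dvd n \<and> p dvd fib (n div q)"
proof -
  define g where "g = gcd m n"
  have g: "g dvd n" "p dvd fib g" "g \<le> m" using assms
    by (auto simp: g_def prime_dvd_fib_gcd intro!: gcd_le1_nat)
  then obtain c where c: "n = g * c" by blast
  have "c \<noteq> 1" using c g assms by auto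
  then obtain q where q: "prime q" "q dvd c" using prime_factor_nat by blast
  then obtain d where d: "c = q * d" by blast
  have "n div q = g * d" using c d q prime_gt_0_nat by simp
  hence "p dvd fib (n div q)" using g(2) fib_dvd_mono dvd_trans dvd_triv_left by metis
  thus ?thesis using q c by auto
qed

text \<open>The left side is the exponent of \<open>p\<close> in the Moebius product. As
  \<open>p\<close> divides an earlier F_m, it divides F_(n/q) for some prime q dividing
  \<open>n\<close>. If q can be chosen different from \<open>p\<close>, then k and qk give equal
  valuations throughout and the pairing by q cancels everything. Otherwise q = p, only the pair n,
  n/p survives, and its difference is bounded by the valuation lemma.\<close>

lemma prime_subset_sum_multiplicity_le:
  fixes p m n :: nat
  assumes p: "prime p" and pn: "p dvd fib n" and pm: "p dvd fib m" and m: "0 < m" "m < n"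
  shows "prime_subset_sum n (\<lambda>k. real (multiplicity p (fib k)))
           \<le> (if p dvd n then (if p = 2 then 2 else 1) else 0)"
proof -
  define P where "P = prime_factors n"
  have n: "n > 0" using m by simp
  have "\<exists>q\<in>P. p dvd fib (n div q)"
    using fib_proper_divisor_dvd[OF p pn pm m] n by (auto simp: P_def in_prime_factors_iff)
  then obtain q0 where q0: "q0 \<in> P" "p dvd fib (n div q0)" by blast
  have mult0: "multiplicity p (fib k) = 0" if "\<not> p dvd fib k" for k
    using that by (rule not_dvd_imp_multiplicity_0)
  show ?thesis
  proof (cases "\<exists>q\<in>P. q \<noteq> p \<and> p dvd fib (n div q)")
    case True
    then obtain q where q: "q \<in> P" "q \<noteq> p" "p dvd fib (n div q)" by blast
    hence qp: "prime q" by (auto simp: P_def in_prime_factors_iff)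
    have "prime_subset_sum n (\<lambda>k. real (multiplicity p (fib k))) = 0"
    proof (subst prime_subset_sum_remove)
      show "q \<in> prime_factors n" using q by (simp add: P_def)
      show "(\<Sum>S\<in>Pow (prime_factors n - {q}). (- 1) ^ card S *
        (real (multiplicity p (fib (n div \<Prod>S))) - real (multiplicity p (fib (n div (q * \<Prod>S)))))) = 0"
      proof (rule sum.neutral, rule ballI)
        fix S assume "S \<in> Pow (prime_factors n - {q})"
        hence S: "S \<subseteq> P" "q \<notin> S" "finite S" by (auto simp: P_def intro: finite_subset)
        have "\<Prod>(insert q S) dvd n" "\<Prod>(insert q S) > 0"
          using prod_prime_subset[of "insert q S" n] S q n by (auto simp: P_def)
        moreover have ins: "\<Prod>(insert q S) = q * \<Prod>S" using S by simp
        ultimately obtain k where k: "n = q * \<Prod>S * k" and pos: "q * \<Prod>S > 0" by auto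
        have k0: "k > 0" using n k by auto
        have d1: "n div (q * \<Prod>S) = k" using k pos by (metis nonzero_mult_div_cancel_left less_not_refl)
        have d2: "n div \<Prod>S = q * k" using k pos by (simp add: mult.commute mult.left_commute)
        have d3: "n div q = k * \<Prod>S" using k pos by (simp add: mult.commute mult.left_commute)
        have cop: "coprime q (\<Prod>S)"
          using S q by (intro prod_coprime_right) (auto simp: P_def in_prime_factors_iff subset_iff intro!: primes_coprime)
        have "multiplicity p (fib (q * k)) = multiplicity p (fib k)"
        proof (cases "p dvd fib k")
          case True
          thus ?thesis using multiplicity_fib_mult_prime(1)[OF p qp k0] q by auto
        next
          case False
          have "\<not> p dvd fib (q * k)"
          proof
            assume "p dvd fib (q * k)"
            hence "p dvd fib (gcd (q * k) (k * \<Prod>S))" using q(3) d3 p prime_dvd_fib_gcd by auto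
            also have "gcd (q * k) (k * \<Prod>S) = k * gcd q (\<Prod>S)"
              by (metis gcd_mult_distrib_nat mult.commute)
            also have "\<dots> = k" using cop by simp
            finally show False using False by simp
          qed
          thus ?thesis using False mult0 by simp
        qed
        thus "(- 1) ^ card S * (real (multiplicity p (fib (n div \<Prod>S))) - real (multiplicity p (fib (n div (q * \<Prod>S))))) = 0"
          unfolding d1 d2 by simp
      qed
    qed
    thus ?thesis by simp
  next
    case False
    hence q0p: "q0 = p" using q0 by blast
    have pP: "p \<in> P" using q0 q0p by simp
    hence pdn: "p dvd n" by (auto simp: P_def in_prime_factors_iff)
    define k where "k = n div p"
    have k: "n = p * k" "k > 0" using pdn n by (auto simp: k_def)
    \<comment> \<open>A nonempty \<open>S\<close> without \<open>p\<close> contains a prime q for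
      which \<open>p\<close> does not divide F_(n/q). Both indices below divide n/q, so both
      valuations vanish and only the empty set contributes.\<close>
    have z: "multiplicity p (fib (n div \<Prod>S)) = 0 \<and> multiplicity p (fib (n div (p * \<Prod>S))) = 0"
      if S: "S \<subseteq> P - {p}" "S \<noteq> {}" for S
    proof -
      obtain q where q: "q \<in> S" using S by blast
      have fin: "finite S" using S by (auto simp: P_def intro: finite_subset)
      have "q dvd \<Prod>S" using q fin by (intro dvd_prodI)
      have pS: "p \<notin> S" using S by blast
      have "\<Prod>(insert p S) dvd n" using prod_prime_subset[of "insert p S" n] S pP n by (auto simp: P_def)
      hence "p * \<Prod>S dvd n" using fin pS by simp
      then obtain l where l: "n = p * \<Prod>S * l" by blast
      obtain c where c: "\<Prod>S = q * c" using \<open>q dvd \<Prod>S\<close> by blast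
      have nz: "p > 0" "q > 0" "c > 0" using n l c by auto
      have e1: "n div q = n div \<Prod>S * c" and e2: "n div \<Prod>S = n div (p * \<Prod>S) * p"
        using nz unfolding l c by (simp_all add: mult.commute mult.left_commute)
      have np: "\<not> p dvd fib (n div q)" using False q S by blast
      have "fib (n div \<Prod>S) dvd fib (n div q)" using e1 by (intro fib_dvd_mono) simp
      moreover have "fib (n div (p * \<Prod>S)) dvd fib (n div \<Prod>S)" using e2 by (intro fib_dvd_mono) simp
      ultimately show ?thesis using np mult0 dvd_trans by metis
    qed
    have "prime_subset_sum n (\<lambda>k. real (multiplicity p (fib k))) =
       (\<Sum>S\<in>Pow (P - {p}). (- 1) ^ card S *
        (real (multiplicity p (fib (n div \<Prod>S))) - real (multiplicity p (fib (n div (p * \<Prod>S))))))"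
      using pP unfolding P_def by (rule prime_subset_sum_remove)
    also have "\<dots> = (\<Sum>S\<in>{{}}. (- 1) ^ card S *
        (real (multiplicity p (fib (n div \<Prod>S))) - real (multiplicity p (fib (n div (p * \<Prod>S))))))"
    proof (rule sum.mono_neutral_right)
      show "finite (Pow (P - {p}))" by (simp add: P_def)
      show "{{}} \<subseteq> Pow (P - {p})" by simp
      show "\<forall>S\<in>Pow (P - {p}) - {{}}. (- 1) ^ card S *
        (real (multiplicity p (fib (n div \<Prod>S))) - real (multiplicity p (fib (n div (p * \<Prod>S))))) = 0"
        using z by auto
    qed
    also have "\<dots> = real (multiplicity p (fib n)) - real (multiplicity p (fib k))"
      by (simp add: k_def)
    also have "\<dots> \<le> (if p = 2 then 2 else 1)"
    proof -
      have "p dvd fib k" using q0 q0p by (simp add: k_def)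
      hence "multiplicity p (fib n) \<le> multiplicity p (fib k) + (if p = 2 then 2 else 1)"
        using multiplicity_fib_mult_prime(2)[OF p p k(2)] k(1) by simp
      thus ?thesis by (auto split: if_splits)
    qed
    finally show ?thesis using pdn by simp
  qed
qed

section \<open>Size of the Moebius product in the absence of primitive primes\<close>

lemma ln_eq_sum_multiplicity:
  assumes "finite Q" "prime_factors k \<subseteq> Q" "k > (0::nat)" "\<And>p. p \<in> Q \<Longrightarrow> prime p"
  shows "ln (real k) = (\<Sum>p\<in>Q. ln (real p) * real (multiplicity p k))"
proof -
  have "real k = (\<Prod>p\<in>prime_factors k. real p ^ multiplicity p k)"
    using prime_factorization_nat[of k] assms(3) by (metis (mono_tags, lifting) of_nat_power of_nat_prod prod.cong)
  hence "ln (real k) = ln (\<Prod>p\<in>prime_factors k. real p ^ multiplicity p k)" by simp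
  also have "\<dots> = (\<Sum>p\<in>prime_factors k. ln (real p ^ multiplicity p k))"
    by (rule ln_prod) (auto simp: in_prime_factors_iff prime_gt_0_nat)
  also have "\<dots> = (\<Sum>p\<in>prime_factors k. ln (real p) * real (multiplicity p k))"
    by (rule sum.cong[OF refl], subst ln_realpow) (auto simp: in_prime_factors_iff prime_gt_0_nat)
  also have "\<dots> = (\<Sum>p\<in>Q. ln (real p) * real (multiplicity p k))"
  proof (rule sum.mono_neutral_left[OF assms(1,2)], rule ballI)
    fix p assume "p \<in> Q - prime_factors k"
    hence "\<not> p dvd k" using assms(3,4) by (auto simp: in_prime_factors_iff)
    thus "ln (real p) * real (multiplicity p k) = 0" by (simp add: not_dvd_imp_multiplicity_0)
  qed
  finally show ?thesis .
qed

text \<open>When every prime factor of F_n has occurred before, only primes dividing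
  \<open>n\<close> can contribute positively, each at most once and 2 at most twice. The sum is then
  at most the logarithm of twice the radical of \<open>n\<close>.\<close>

lemma prime_subset_sum_ln_fib_le:
  assumes n: "n > 0" and np: "\<And>p. prime p \<Longrightarrow> p dvd fib n \<Longrightarrow> \<exists>m. 0 < m \<and> m < n \<and> p dvd fib m"
  shows "prime_subset_sum n (\<lambda>k. ln (real (fib k))) \<le> ln (2 * real n)"
proof -
  define Q where "Q = prime_factors (fib n)"
  have fn: "fib n > 0" using n by (rule fib_neq_0_nat)
  have "prime_subset_sum n (\<lambda>k. ln (real (fib k))) =
        prime_subset_sum n (\<lambda>k. \<Sum>p\<in>Q. ln (real p) * real (multiplicity p (fib k)))"
  proof (rule prime_subset_sum_cong[OF _ n])
    fix k assume k: "k dvd n" "k > 0"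
    hence "prime_factors (fib k) \<subseteq> Q" unfolding Q_def using fn fib_dvd_mono[of k n]
      by (intro dvd_prime_factors) auto
    thus "ln (real (fib k)) = (\<Sum>p\<in>Q. ln (real p) * real (multiplicity p (fib k)))"
      using fib_neq_0_nat[OF k(2)] by (intro ln_eq_sum_multiplicity) (auto simp: Q_def in_prime_factors_iff)
  qed
  also have "\<dots> = (\<Sum>p\<in>Q. ln (real p) * prime_subset_sum n (\<lambda>k. real (multiplicity p (fib k))))"
    by (simp add: prime_subset_sum_sum prime_subset_sum_cmult)
  also have "\<dots> \<le> (\<Sum>p\<in>Q. ln (real p) * (if p dvd n then (if p = 2 then 2 else 1) else 0))"
  proof (intro sum_mono mult_left_mono)
    fix p assume "p \<in> Q"
    hence p: "prime p" "p dvd fib n" by (auto simp: Q_def in_prime_factors_iff)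
    obtain m where m: "0 < m" "m < n" "p dvd fib m" using np[OF p] by blast
    show "prime_subset_sum n (\<lambda>k. real (multiplicity p (fib k))) \<le> (if p dvd n then (if p = 2 then 2 else 1) else 0)"
      using prime_subset_sum_multiplicity_le[OF p m(3,1,2)] .
    show "0 \<le> ln (real p)" using p prime_ge_1_nat by (simp add: Suc_leI prime_gt_0_nat)
  qed
  also have "\<dots> = (\<Sum>p\<in>Q \<inter> prime_factors n. ln (real p) * (if p = 2 then 2 else 1))"
  proof (rule sum.mono_neutral_cong_right)
    show "finite Q" by (simp add: Q_def)
  qed (use n in \<open>auto simp: in_prime_factors_iff Q_def\<close>)
  also have "\<dots> \<le> (\<Sum>p\<in>prime_factors n. ln (real p) * (if p = 2 then 2 else 1))"
    by (intro sum_mono2) (auto simp: in_prime_factors_iff Suc_leI prime_gt_0_nat)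
  also have "\<dots> = (\<Sum>p\<in>prime_factors n. ln (real p) + (if p = 2 then ln 2 else 0))"
    by (intro sum.cong) auto
  also have "\<dots> = (\<Sum>p\<in>prime_factors n. ln (real p)) + (if 2 \<in> prime_factors n then ln 2 else 0)"
    by (simp add: sum.distrib)
  also have "(\<Sum>p\<in>prime_factors n. ln (real p)) = ln (real (\<Prod>(prime_factors n)))"
    unfolding of_nat_prod by (rule ln_prod[symmetric]) (auto simp: in_prime_factors_iff prime_gt_0_nat)
  also have "\<dots> \<le> ln (real n)"
    using prod_prime_subset[of "prime_factors n" n] n
    by (subst ln_le_cancel_iff) (auto simp del: of_nat_prod intro: dvd_imp_le)
  finally have "prime_subset_sum n (\<lambda>k. ln (real (fib k))) \<le>
      ln (real n) + (if 2 \<in> prime_factors n then ln 2 else 0)" by simp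
  also have "\<dots> \<le> ln (real n) + ln 2" by (intro add_left_mono) simp
  finally have "prime_subset_sum n (\<lambda>k. ln (real (fib k))) \<le> ln (real n) + ln 2" .
  moreover have "ln (2 * real n) = ln 2 + ln (real n)" using n by (intro ln_mult_pos) auto
  ultimately show ?thesis by linarith
qed

section \<open>A lower bound for the totient\<close>

lemma prod_ge_prod_sub:
  fixes w :: "nat \<Rightarrow> real"
  assumes "finite P" "\<And>p. p \<in> P \<Longrightarrow> p \<notin> {2, 3} \<Longrightarrow> w p = 1" "w 2 = 1/8" "w 3 = 16/27"
  shows "(\<Prod>p\<in>P. w p) \<ge> 2 / 27"
proof -
  have eq: "(\<Prod>p\<in>P. w p) = (\<Prod>p\<in>P \<inter> {2,3}. w p)"
    using assms(1,2) by (intro prod.mono_neutral_right) auto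
  consider "P \<inter> {2,3} = {}" | "P \<inter> {2,3} = {2}" | "P \<inter> {2,3} = {3}" | "P \<inter> {2,3} = {2,3}"
    by blast
  hence "(\<Prod>p\<in>P \<inter> {2,3}. w p) \<ge> 2 / 27"
    by cases (simp_all add: assms(3,4))
  with eq show ?thesis by simp
qed

text \<open>With rad the product of the primes dividing \<open>n\<close>, the product of p (1 -
  1/p)^4 over these primes is rad * (phi/n)^4, at most phi^4/n^3. A factor with p >= 4 is at least 4
  (3/4)^4 > 1, while p = 2 and p = 3 give exactly 1/8 and 16/27, whose product is 2/27.\<close>

lemma totient_power4_ge:
  assumes "n > 0"
  shows "2 * real n ^ 3 \<le> 27 * real (totient n) ^ 4"
proof -
  define P where "P = prime_factors n"
  define w where "w p = (if p = 2 then 1/8 else if p = 3 then 16/27 else (1::real))" for p :: nat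
  have ge2: "p \<ge> 2" if "p \<in> P" for p using that by (auto simp: P_def in_prime_factors_iff prime_ge_2_nat)
  have "2 / 27 \<le> (\<Prod>p\<in>P. w p)" by (rule prod_ge_prod_sub) (auto simp: P_def w_def)
  also have "\<dots> \<le> (\<Prod>p\<in>P. real p * (1 - 1 / real p) ^ 4)"
  proof (rule prod_mono)
    fix p assume p: "p \<in> P"
    hence pr: "prime p" by (auto simp: P_def in_prime_factors_iff)
    consider "p = 2" | "p = 3" | "p \<ge> 4" using ge2[OF p] by linarith
    thus "0 \<le> w p \<and> w p \<le> real p * (1 - 1 / real p) ^ 4"
    proof cases
      case 3
      hence "3/4 \<le> 1 - 1 / real p" by (simp add: field_simps)
      hence "(3/4) ^ 4 \<le> (1 - 1 / real p) ^ 4" by (intro power_mono) auto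
      hence "4 * (3/4) ^ 4 \<le> real p * (1 - 1 / real p) ^ 4" using 3 by (intro mult_mono) auto
      thus ?thesis using 3 by (simp add: w_def power_divide)
    qed (simp_all add: w_def power_divide)
  qed
  also have "\<dots> = real (\<Prod>P) * (\<Prod>p\<in>P. 1 - 1 / real p) ^ 4"
    by (simp add: prod.distrib prod_power_distrib)
  also have "\<dots> \<le> real n * (\<Prod>p\<in>P. 1 - 1 / real p) ^ 4"
    using prod_prime_subset[of P n] assms
    by (intro mult_right_mono) (auto simp: P_def simp del: of_nat_prod intro: dvd_imp_le)
  finally have "2 / 27 * real n ^ 3 \<le> (real n * (\<Prod>p\<in>P. 1 - 1 / real p) ^ 4) * real n ^ 3"
    by (intro mult_right_mono) auto
  also have "\<dots> = (real n * (\<Prod>p\<in>P. 1 - 1 / real p)) ^ 4"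
    by (simp add: power_mult_distrib power4_eq_xxxx power3_eq_cube)
  also have "real n * (\<Prod>p\<in>P. 1 - 1 / real p) = real (totient n)"
    unfolding P_def by (rule totient_formula2[symmetric])
  finally show ?thesis by simp
qed

section \<open>Growth of the Moebius product and large indices\<close>

definition golden :: real where "golden = (1 + sqrt 5) / 2"

lemma golden_bounds: "1.618 < golden" "golden < 1.619"
proof -
  have "2.236 < sqrt 5" by (rule real_less_rsqrt) (simp add: power2_eq_square)
  moreover have "sqrt 5 < 2.238" by (rule real_less_lsqrt) (simp_all add: power2_eq_square)
  ultimately show "1.618 < golden" "golden < 1.619" by (simp_all add: golden_def)
qed

lemma golden_square: "golden\<^sup>2 = golden + 1"
  unfolding golden_def power_divide power2_sum by simp

text \<open>Binet's formula with golden^n factored out: the conjugate root is -1/golden, so the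
  relative correction is a power of -1/golden^2.\<close>

lemma fib_golden:
  "real (fib n) * sqrt 5 = golden ^ n * (1 - (- inverse (golden\<^sup>2)) ^ n)"
proof -
  have g: "golden > 0" using golden_bounds by simp
  have "(1 - sqrt 5) / 2 * golden = -1" by (simp add: golden_def field_simps)
  hence conj: "(1 - sqrt 5) / 2 = - inverse golden" using g by (metis mult_minus1 mult.assoc right_inverse mult.right_neutral less_irrefl)
  have "real (fib n) * sqrt 5 = golden ^ n - (- inverse golden) ^ n"
    using fib_closed_form[of n] unfolding conj golden_def[symmetric] by simp
  also have "(- inverse golden) ^ n = golden ^ n * (- inverse (golden\<^sup>2)) ^ n"
    using g by (simp add: power_mult_distrib[symmetric] power2_eq_square mult.assoc[symmetric])
  finally show ?thesis by (simp add: algebra_simps)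
qed

lemma abs_ln_one_minus_le:
  fixes x :: real
  assumes "\<bar>x\<bar> < 1"
  shows "\<bar>ln (1 - x)\<bar> \<le> \<bar>x\<bar> / (1 - \<bar>x\<bar>)"
proof -
  have pos: "1 - x > 0" "1 - \<bar>x\<bar> > 0" using assms by auto
  have "ln (1 - x) \<le> - x" using ln_le_minus_one[OF pos(1)] by simp
  also have "- x \<le> \<bar>x\<bar> / (1 - \<bar>x\<bar>)"
  proof -
    have "\<bar>x\<bar> * (1 - \<bar>x\<bar>) \<le> \<bar>x\<bar>" by (simp add: mult_left_le)
    hence "\<bar>x\<bar> \<le> \<bar>x\<bar> / (1 - \<bar>x\<bar>)" using pos by (simp add: field_simps)
    thus ?thesis by linarith
  qed
  finally have 1: "ln (1 - x) \<le> \<bar>x\<bar> / (1 - \<bar>x\<bar>)" .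
  have "- ln (1 - x) = ln (inverse (1 - x))" using pos by (simp add: ln_inverse)
  also have "\<dots> \<le> inverse (1 - x) - 1" using pos by (intro ln_le_minus_one) auto
  also have "\<dots> = x / (1 - x)" using pos by (simp add: field_simps)
  also have "\<dots> \<le> \<bar>x\<bar> / (1 - \<bar>x\<bar>)" using pos by (intro frac_le) auto
  finally show ?thesis using 1 by (simp add: abs_le_iff)
qed

text \<open>In ln F_k = k ln golden - ln (sqrt 5) + \<open>e k\<close> the linear part contributes
  phi(n) ln golden and the constant disappears because n > 1. The errors add up to at most golden *
  r/(1 - r), which is 1 since r = golden^(-2) and 1 - r = golden^(-1). Exponentiating phi(n) ln
  golden - 1 <= ln (2n) costs a factor exp 1 <= 3, whence the 6.\<close>

lemma golden_power_totient_le: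
  assumes n: "n > 1" and np: "\<And>p. prime p \<Longrightarrow> p dvd fib n \<Longrightarrow> \<exists>m. 0 < m \<and> m < n \<and> p dvd fib m"
  shows "golden ^ totient n \<le> 6 * real n"
proof -
  define r where "r = inverse (golden\<^sup>2)"
  have g: "golden > 0" "golden > 1" using golden_bounds by simp_all
  have r: "r > 0" "r < 1" using g by (simp_all add: r_def power2_eq_square field_simps less_1_mult')
  have r1: "1 - r = inverse golden" using golden_square g unfolding r_def
    by (simp add: field_simps power2_eq_square)
  define e where "e k = ln (1 - (- r) ^ k)" for k
  have xr: "\<bar>(- r) ^ k\<bar> \<le> r" if "k \<ge> 1" for k
    using r that power_decreasing[of 1 k r] by (simp add: power_abs)
  have e: "\<bar>e k\<bar> \<le> r ^ k * golden" if k: "k \<ge> 1" for k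
  proof -
    have "\<bar>e k\<bar> \<le> \<bar>(- r) ^ k\<bar> / (1 - \<bar>(- r) ^ k\<bar>)" unfolding e_def
      using xr[OF k] r by (intro abs_ln_one_minus_le) linarith
    also have "\<dots> \<le> \<bar>(- r) ^ k\<bar> / (1 - r)" using xr[OF k] r by (intro divide_left_mono mult_pos_pos) auto
    also have "\<dots> = r ^ k * golden" using r unfolding r1 by (simp add: power_abs divide_inverse)
    finally show ?thesis .
  qed
  have ln_fib: "ln (real (fib k)) = (ln golden * real k + (- ln (sqrt 5))) + e k" if k: "k > 0" for k
  proof -
    have "(- r) ^ k \<le> \<bar>(- r) ^ k\<bar>" by (rule abs_ge_self)
    hence "1 - (- r) ^ k > 0" using xr[of k] k r by linarith
    hence "ln (real (fib k) * sqrt 5) = ln (golden ^ k) + e k"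
      using g unfolding fib_golden e_def r_def by (intro ln_mult_pos) auto
    moreover have "ln (real (fib k) * sqrt 5) = ln (real (fib k)) + ln (sqrt 5)"
      using fib_neq_0_nat[OF k] by (intro ln_mult_pos) auto
    ultimately show ?thesis using g by (simp add: ln_realpow mult.commute)
  qed
  have "prime_subset_sum n (\<lambda>k. ln (real (fib k))) = prime_subset_sum n (\<lambda>k. (ln golden * real k + (- ln (sqrt 5))) + e k)"
    using n ln_fib by (intro prime_subset_sum_cong) auto
  also have "\<dots> = ln golden * real (totient n) + prime_subset_sum n e"
    using n unfolding prime_subset_sum_add prime_subset_sum_cmult
    by (simp add: prime_subset_sum_const prime_subset_sum_real)
  finally have 1: "prime_subset_sum n (\<lambda>k. ln (real (fib k))) = ln golden * real (totient n) + prime_subset_sum n e" .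
  have "\<bar>prime_subset_sum n e\<bar> \<le> (\<Sum>m=1..n. \<bar>e m\<bar>)" using n by (intro abs_prime_subset_sum_le) auto
  also have "\<dots> \<le> (\<Sum>m=1..n. r ^ m * golden)" using e by (intro sum_mono) auto
  also have "\<dots> = (\<Sum>m=1..n. r ^ m) * golden" by (simp add: sum_distrib_right)
  also have "(\<Sum>m=1..n. r ^ m) \<le> r / (1 - r)"
  proof -
    have "(\<Sum>m=1..n. r ^ m) = r * (\<Sum>m<n. r ^ m)"
      by (simp add: sum_distrib_left sum.shift_bounds_cl_Suc_ivl sum.atLeast1_atMost_eq)
    also have "(\<Sum>m<n. r ^ m) = (1 - r ^ n) / (1 - r)" using r by (simp add: sum_gp_strict)
    also have "r * \<dots> \<le> r * (1 / (1 - r))" using r by (intro mult_left_mono divide_right_mono) auto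
    finally show ?thesis by simp
  qed
  also have "r / (1 - r) * golden = 1" unfolding r1 using g by (simp add: r_def power2_eq_square)
  finally have 2: "- 1 \<le> prime_subset_sum n e" using g by simp
  have "ln golden * real (totient n) - 1 \<le> ln (2 * real n)"
    using prime_subset_sum_ln_fib_le[of n] n np 1 2 by fastforce
  hence "ln (golden ^ totient n) \<le> ln (2 * real n) + 1" using g by (simp add: ln_realpow mult.commute)
  hence "exp (ln (golden ^ totient n)) \<le> exp (ln (2 * real n) + 1)" by simp
  hence "golden ^ totient n \<le> exp (ln (2 * real n) + 1)" using g by simp
  also have "\<dots> = 2 * real n * exp 1" using n by (simp add: exp_add)
  also have "\<dots> \<le> 2 * real n * 3" using exp_le by (intro mult_left_mono) auto
  finally show ?thesis by simp
qed

text \<open>\<open>1.61\<close> is a rational lower bound for \<open>golden\<close>. A step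
  multiplies the left side by at most (14/13)^4 < 4 and the right side by 1.61^3 > 4. The inequality
  fails at t = 12, which dictates the starting value.\<close>

lemma power4_less_golden_power:
  assumes "t \<ge> 13"
  shows "2916 * real t ^ 4 < 1.61 ^ (3 * t)"
  using assms
proof (induction t rule: dec_induct)
  case base
  show ?case by (simp add: power_divide)
next
  case (step t)
  have "real (Suc t) \<le> (14/13) * real t" using step(1) by simp
  hence "real (Suc t) ^ 4 \<le> ((14/13) * real t) ^ 4" by (intro power_mono) auto
  also have "\<dots> \<le> 4 * real t ^ 4" by (simp add: power_mult_distrib power_divide)
  finally have "2916 * real (Suc t) ^ 4 \<le> 4 * (2916 * real t ^ 4)" by linarith
  also have "\<dots> < 4 * 1.61 ^ (3 * t)" using step.IH by linarith
  also have "\<dots> \<le> 1.61 ^ 3 * 1.61 ^ (3 * t)" by (intro mult_right_mono) (auto simp: power3_eq_cube)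
  also have "\<dots> = 1.61 ^ (3 * Suc t)" unfolding power_add[symmetric] by simp
  finally show ?case .
qed

text \<open>Cubing golden^t <= 6n, with t = phi(n), brings in n^3, which the totient bound turns
  into t^4; 2916 is 108 * 27. The threshold 66 is the least \<open>n\<close> for which 2 n^3 exceeds
  27 * 12^4, so that t >= 13 is guaranteed.\<close>

lemma fib_primitive_prime_large:
  assumes "n \<ge> 66"
  shows "\<exists>p. prime p \<and> p dvd fib n \<and> (\<forall>m. 0 < m \<and> m < n \<longrightarrow> \<not> p dvd fib m)"
proof (rule ccontr)
  assume "\<not> ?thesis"
  hence "golden ^ totient n \<le> 6 * real n" using assms by (intro golden_power_totient_le) auto
  hence "(golden ^ totient n) ^ 3 \<le> (6 * real n) ^ 3" using golden_bounds by (intro power_mono) auto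
  also have "\<dots> = 108 * (2 * real n ^ 3)" by (simp add: power_mult_distrib)
  also have "\<dots> \<le> 108 * (27 * real (totient n) ^ 4)"
    using totient_power4_ge[of n] assms by (intro mult_left_mono) auto
  finally have 1: "golden ^ (3 * totient n) \<le> 2916 * real (totient n) ^ 4"
    by (simp add: power_mult[symmetric] mult.commute)
  have "totient n \<ge> 13"
  proof (rule ccontr)
    assume "\<not> totient n \<ge> 13"
    hence "real (totient n) ^ 4 \<le> 12 ^ 4" by (intro power_mono) auto
    moreover have "(66::real) ^ 3 \<le> real n ^ 3" using assms by (intro power_mono) auto
    ultimately show False using totient_power4_ge[of n] assms by simp
  qed
  hence "2916 * real (totient n) ^ 4 < 1.61 ^ (3 * totient n)" by (rule power4_less_golden_power)
  also have "\<dots> \<le> golden ^ (3 * totient n)" using golden_bounds by (intro power_mono) auto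
  finally show False using 1 by simp
qed

section \<open>Small indices by certificates\<close>

lemma gen_fib_numeral:
  "gen_fib a b (numeral k) = gen_fib b (a + b) (pred_numeral k)"
  unfolding numeral_eq_Suc by (cases "pred_numeral k") auto

lemma fib_small: "fib 3 = 2" "fib 4 = 3" "fib 5 = 5"
  by (simp_all add: eval_nat_numeral)

lemma fib_numeral_gen_fib:
  "3 \<le> (numeral k :: nat) \<Longrightarrow> fib (numeral k :: nat) = gen_fib 2 3 (numeral k - 3)"
proof -
  assume "3 \<le> (numeral k :: nat)"
  moreover have "fib 3 = 2" "fib (Suc 3) = 3" by (simp_all add: eval_nat_numeral)
  ultimately show ?thesis using gen_fib_fib[of 3 "numeral k - 3"] by (simp only: le_add_diff_inverse)
qed

text \<open>One step of Euclid's algorithm as a rewrite rule, so that coprimality in the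
  certificates is decided by simplification.\<close>

lemma coprime_numeral_mod:
  "coprime (numeral a :: nat) (numeral b) \<longleftrightarrow> coprime (numeral b :: nat) (numeral a mod numeral b)"
  by (metis coprime_commute coprime_mod_left_iff zero_neq_numeral)

text \<open>A divisor \<open>g\<close> of \<open>F\<^sub>n\<close> that is coprime to \<open>F\<close> at every \<open>n/q\<close> certifies a primitive prime without
  any primality test; for \<open>n \<le> 65\<close> and \<open>q \<ge> 11\<close> the value of \<open>F\<close> at \<open>n/q\<close> divides \<open>30\<close>.\<close>

definition fib_certificate :: "nat \<times> nat \<Rightarrow> bool" where
  "fib_certificate = (\<lambda>(n, g). 1 < g \<and> g dvd fib n \<and> coprime g 30 \<and>
     (\<forall>q\<in>{2, 3, 5, 7}. q dvd n \<longrightarrow> coprime g (fib (n div q))))"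

lemma fib_certificate_primitive:
  assumes cert: "fib_certificate (n, g)" and n: "0 < n" "n \<le> 65"
  shows "\<exists>p. prime p \<and> p dvd fib n \<and> (\<forall>m. 0 < m \<and> m < n \<longrightarrow> \<not> p dvd fib m)"
proof -
  have g: "1 < g" "g dvd fib n" "coprime g 30" "\<And>q. q \<in> {2,3,5,7} \<Longrightarrow> q dvd n \<Longrightarrow> coprime g (fib (n div q))"
    using cert by (auto simp: fib_certificate_def)
  obtain p where p: "prime p" "p dvd g" using g(1) prime_factor_nat[of g] by auto
  have cop: "\<not> p dvd k" if "coprime g k" for k
    using that p by (metis coprime_common_divisor not_prime_unit)
  have "\<not> p dvd fib m" if m: "0 < m" "m < n" for m
  proof
    assume "p dvd fib m"
    then obtain q where q: "prime q" "q dvd n" "p dvd fib (n div q)"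
      using fib_proper_divisor_dvd[of p n m] p g(2) m dvd_trans by blast
    have "q \<notin> {2,3,5,7}" using g(4) q cop by blast
    moreover have "even q \<Longrightarrow> q = 2" "3 dvd q \<Longrightarrow> q = 3"
      using primes_dvd_imp_eq[OF _ q(1), of 2] primes_dvd_imp_eq[OF _ q(1), of 3] by auto
    hence "q \<noteq> 4" "q \<noteq> 6" "q \<noteq> 8" "q \<noteq> 9" "q \<noteq> 10" by auto
    moreover have "q \<noteq> 0" "q \<noteq> 1" using q(1) by auto
    moreover have "q \<in> {0,1,2,3,4,5,6,7,8,9,10}" if "q < 11"
      using that by (simp add: eval_nat_numeral less_Suc_eq)
    ultimately have "q \<ge> 11" by (metis insertE insertI1 insertI2 not_le_imp_less singletonD)
    hence "n div q \<le> 65 div 11" using n by (meson div_le_mono div_le_mono2 le_trans zero_less_numeral)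
    hence "n div q \<in> {0,1,2,3,4,5}" by auto
    moreover have "n div q \<noteq> 0" using q(2) n by (auto elim!: dvdE)
    ultimately have "fib (n div q) dvd 30" by (auto simp: fib_small)
    thus False using cop[OF g(3)] q(3) dvd_trans by blast
  qed
  thus ?thesis using p g(2) dvd_trans by blast
qed

definition fib_certificate_table :: "(nat \<times> nat) list" where
  "fib_certificate_table =
   [(7, 13), (8, 7), (9, 17), (10, 11), (11, 89), (13, 233), (14, 29), (15, 61), (16, 47), 
    (17, 1597), (18, 19), (19, 37), (20, 41), (21, 421), (22, 199), (23, 28657), (24, 23), 
    (25, 3001), (26, 521), (27, 53), (28, 281), (29, 514229), (30, 31), (31, 557), (32, 2207), 
    (33, 19801), (34, 3571), (35, 141961), (36, 107), (37, 73), (38, 9349), (39, 135721), 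
    (40, 2161), (41, 2789), (42, 211), (43, 433494437), (44, 43), (45, 109441), (46, 139), 
    (47, 2971215073), (48, 1103), (49, 97), (50, 101), (51, 6376021), (52, 90481), (53, 953), 
    (54, 5779), (55, 661), (56, 14503), (57, 797), (58, 59), (59, 353), (60, 2521), (61, 4513), 
    (62, 3010349), (63, 35239681), (64, 1087), (65, 14736206161)]"

lemma fib_certificate_table_valid:
  "list_all fib_certificate
   fib_certificate_table"
  by (simp add: fib_certificate_table_def fib_certificate_def fib_numeral_gen_fib gen_fib_numeral coprime_numeral_mod)

text \<open>The primitive primes at n = 3, 4, 5 are 2, 3, 5, which certificates cannot show since
  they demand coprimality to 30. There F_n is itself a prime exceeding all earlier values.\<close>

lemma fib_primitive_prime:
  assumes "n \<ge> 3" "n \<noteq> 6" "n \<noteq> 12"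
  shows "\<exists>p. prime p \<and> p dvd fib n \<and> (\<forall>m. 0 < m \<and> m < n \<longrightarrow> \<not> p dvd fib m)"
proof -
  have small: ?thesis if "n = Suc k" "prime p" "p dvd fib (Suc k)" "fib k < p" for k p
  proof -
    have "\<not> p dvd fib m" if "0 < m" "m < n" for m
      using that fib_mono[of m k] \<open>fib k < p\<close> \<open>n = Suc k\<close> fib_neq_0_nat[of m] by (auto dest!: dvd_imp_le)
    thus ?thesis using that by blast
  qed
  consider "n \<ge> 66" | "n = 3" | "n = 4" | "n = 5" | "n \<ge> 7" "n < 66" using assms by linarith
  thus ?thesis
  proof cases
    case 1
    thus ?thesis by (rule fib_primitive_prime_large)
  next
    case 2
    thus ?thesis by (intro small[of 2 2]) (simp_all add: fib_small)
  next
    case 3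
    thus ?thesis by (intro small[of 3 3]) (simp_all add: fib_small)
  next
    case 4
    thus ?thesis by (intro small[of 4 5]) (simp_all add: fib_small)
  next
    case 5
    have "\<exists>g. fib_certificate (n, g)"
    proof -
      have "set [7..<66] \<subseteq> insert 12 (fst ` set fib_certificate_table)"
        by (simp add: upt_rec fib_certificate_table_def)
      moreover have "n \<in> set [7..<66]" using 5 by (simp only: set_upt atLeastLessThan_iff simp_thms)
      ultimately have "n \<in> fst ` set fib_certificate_table" using assms(3) by blast
      thus ?thesis using fib_certificate_table_valid unfolding list_all_iff by force
    qed
    then obtain g where "fib_certificate (n, g)" by blast
    thus ?thesis using 5 by (intro fib_certificate_primitive[of n g]) auto
  qed
qed

section \<open>Simultaneous approximation of the phases\<close>

text \<open>Kronecker's theorem gives one time for one target. Relative density follows by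
  compactness: one time \<open>T g\<close> is fixed for each of the finitely many grid points g/m of
  the torus, and \<open>R\<close> exceeds all of them. For a window centred at \<open>b\<close>, the
  target \<alpha> - b \<theta> is rounded to the grid modulo 1; \<open>b + T g\<close> lies in the
  window and errs by at most \<epsilon>/2 from rounding plus \<epsilon>/2 from
  approximation.\<close>

theorem Kronecker_relatively_dense:
  fixes \<theta> :: "nat \<Rightarrow> real" and n :: nat
  assumes indp: "module.independent (\<lambda>r. (*) (real_of_int r)) (\<theta> ` {..<n})"
    and inj: "inj_on \<theta> {..<n}" and "\<epsilon> > 0"
  shows "\<exists>L>0. \<forall>a \<alpha>. \<exists>t\<in>{a<..<a + L}. \<exists>h. \<forall>i<n. \<bar>t * \<theta> i - of_int (h i) - \<alpha> i\<bar> < \<epsilon>"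
proof -
  obtain M :: nat where M: "inverse (real (Suc M)) < \<epsilon> / 2"
    using reals_Archimedean[of "\<epsilon> / 2"] \<open>\<epsilon> > 0\<close> by auto
  define m where "m = Suc M"
  have m: "m > 0" "1 / real m < \<epsilon> / 2" using M by (auto simp: m_def inverse_eq_divide)
  define G where "G = PiE {..<n} (\<lambda>_. {..<m})"
  have "finite G" unfolding G_def by (intro finite_PiE) auto
  have "\<forall>g. \<exists>t. \<exists>h. \<forall>i<n. \<bar>t * \<theta> i - of_int (h i) - real (g i) / real m\<bar> < \<epsilon> / 2"
  proof
    fix g :: "nat \<Rightarrow> nat"
    show "\<exists>t. \<exists>h. \<forall>i<n. \<bar>t * \<theta> i - of_int (h i) - real (g i) / real m\<bar> < \<epsilon> / 2"
      using Kronecker_thm_1[OF indp inj, of "\<epsilon> / 2" "\<lambda>i. real (g i) / real m"] \<open>\<epsilon> > 0\<close> by (metis half_gt_zero)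
  qed
  then obtain T where T: "\<And>g. \<exists>h. \<forall>i<n. \<bar>T g * \<theta> i - of_int (h i) - real (g i) / real m\<bar> < \<epsilon> / 2"
    by metis
  define R where "R = 1 + (\<Sum>g\<in>G. \<bar>T g\<bar>)"
  have R: "\<bar>T g\<bar> < R" if "g \<in> G" for g
    using member_le_sum[of g G "\<lambda>g. \<bar>T g\<bar>"] \<open>finite G\<close> that unfolding R_def by simp
  have "R > 0" unfolding R_def by (intro add_pos_nonneg sum_nonneg) auto
  show ?thesis
  proof (intro exI[of _ "2 * R"] conjI allI)
    show "2 * R > 0" using \<open>R > 0\<close> by simp
    fix a :: real and \<alpha> :: "nat \<Rightarrow> real"
    define b where "b = a + R"
    define \<beta> where "\<beta> i = frac (\<alpha> i - b * \<theta> i)" for i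
    define g where "g = restrict (\<lambda>i. nat \<lfloor>real m * \<beta> i\<rfloor>) {..<n}"
    have beta: "0 \<le> \<beta> i" "\<beta> i < 1" for i by (simp_all add: \<beta>_def frac_lt_1)
    have gG: "g \<in> G"
    proof -
      have "nat \<lfloor>real m * \<beta> i\<rfloor> < m" for i
      proof -
        have "real m * \<beta> i < real m * 1" using beta[of i] m by (intro mult_strict_left_mono) auto
        hence "\<lfloor>real m * \<beta> i\<rfloor> < int m" by (simp add: floor_less_iff)
        thus ?thesis using m by linarith
      qed
      thus ?thesis by (auto simp: G_def g_def)
    qed
    have gb: "\<bar>real (g i) / real m - \<beta> i\<bar> \<le> 1 / real m" if "i < n" for i
    proof -
      have "0 \<le> real m * \<beta> i" using beta m by simp
      hence "real (g i) = of_int \<lfloor>real m * \<beta> i\<rfloor>" using that by (simp add: g_def)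
      hence "\<bar>real (g i) - real m * \<beta> i\<bar> \<le> 1" by linarith
      moreover have "real (g i) / real m - \<beta> i = (real (g i) - real m * \<beta> i) / real m"
        using m by (simp add: diff_divide_distrib)
      ultimately show ?thesis by (simp add: divide_right_mono)
    qed
    obtain h where h: "\<And>i. i < n \<Longrightarrow> \<bar>T g * \<theta> i - of_int (h i) - real (g i) / real m\<bar> < \<epsilon> / 2"
      using T by blast
    show "\<exists>t\<in>{a<..<a + 2 * R}. \<exists>h. \<forall>i<n. \<bar>t * \<theta> i - of_int (h i) - \<alpha> i\<bar> < \<epsilon>"
    proof (intro bexI[of _ "b + T g"] exI[of _ "\<lambda>i. h i - \<lfloor>\<alpha> i - b * \<theta> i\<rfloor>"] allI impI)
      show "b + T g \<in> {a<..<a + 2 * R}" using R[OF gG] by (auto simp: b_def)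
      fix i assume i: "i < n"
      have "(b + T g) * \<theta> i - of_int (h i - \<lfloor>\<alpha> i - b * \<theta> i\<rfloor>) - \<alpha> i
          = (T g * \<theta> i - of_int (h i) - real (g i) / real m) + (real (g i) / real m - \<beta> i)"
        by (simp add: \<beta>_def frac_def algebra_simps)
      thus "\<bar>(b + T g) * \<theta> i - of_int (h i - \<lfloor>\<alpha> i - b * \<theta> i\<rfloor>) - \<alpha> i\<bar> < \<epsilon>"
        using h[OF i] gb[OF i] m by linarith
    qed
  qed
qed

text \<open>Exponentiating and separating positive from negative coefficients gives an equality of
  two products of Fibonacci powers over disjoint index sets. A primitive prime of the largest index
  that occurs divides only the side containing that index.\<close>

lemma ln_fib_linear_independent:
  fixes c :: "nat \<Rightarrow> int"
  assumes J: "finite J" "J \<subseteq> {3..} - {6, 12}" and sum: "(\<Sum>i\<in>J. of_int (c i) * ln (real (fib i))) = 0"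
    and n: "n \<in> J"
  shows "c n = 0"
proof (rule ccontr)
  assume cn: "c n \<noteq> 0"
  define K where "K = {i\<in>J. c i \<noteq> 0}"
  have K: "finite K" "K \<noteq> {}" using J n cn by (auto simp: K_def)
  define N where "N = Max K"
  have N: "N \<in> K" "\<And>i. i \<in> K \<Longrightarrow> i \<le> N" using K by (auto simp: N_def)
  define A B where "A = {i\<in>K. c i > 0}" and "B = {i\<in>K. c i < 0}"
  define P where "P S = (\<Prod>i\<in>S. fib i ^ nat \<bar>c i\<bar>)" for S
  have AB: "finite A" "finite B" "A \<inter> B = {}" "K = A \<union> B"
    using K(1) by (simp_all add: A_def B_def) (auto simp: K_def)
  have pos: "fib i > 0" if "i \<in> K" for i using that J by (intro fib_neq_0_nat) (auto simp: K_def)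
  have lnP: "ln (real (P S)) = (\<Sum>i\<in>S. of_int \<bar>c i\<bar> * ln (real (fib i)))" if S: "S \<subseteq> K" for S
  proof -
    have fin: "finite S" using S K finite_subset by blast
    have "ln (real (P S)) = (\<Sum>i\<in>S. ln (real (fib i) ^ nat \<bar>c i\<bar>))"
      unfolding P_def of_nat_prod of_nat_power using S fin pos by (intro ln_prod) auto
    also have "\<dots> = (\<Sum>i\<in>S. of_int \<bar>c i\<bar> * ln (real (fib i)))"
    proof (rule sum.cong[OF refl])
      fix i assume "i \<in> S"
      hence "fib i > 0" using S pos by blast
      thus "ln (real (fib i) ^ nat \<bar>c i\<bar>) = of_int \<bar>c i\<bar> * ln (real (fib i))"
        by (simp add: ln_realpow)
    qed
    finally show ?thesis .
  qed
  have "0 = (\<Sum>i\<in>K. of_int (c i) * ln (real (fib i)))"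
    unfolding sum[symmetric] using J by (intro sum.mono_neutral_right) (auto simp: K_def)
  also have "\<dots> = (\<Sum>i\<in>A. of_int (c i) * ln (real (fib i))) + (\<Sum>i\<in>B. of_int (c i) * ln (real (fib i)))"
    unfolding AB(4) using AB by (intro sum.union_disjoint) auto
  also have "(\<Sum>i\<in>A. of_int (c i) * ln (real (fib i))) = ln (real (P A))"
    using AB(4) by (subst lnP) (auto intro!: sum.cong simp: A_def)
  also have "(\<Sum>i\<in>B. of_int (c i) * ln (real (fib i))) = - ln (real (P B))"
    using AB(4) by (subst lnP) (auto intro!: sum.cong simp: B_def sum_negf[symmetric])
  finally have "ln (real (P A)) = ln (real (P B))" by simp
  moreover have "P A > 0" "P B > 0" unfolding P_def using AB pos by (auto intro!: prod_pos)
  ultimately have eq: "P A = P B" by simp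
  have "N \<in> {3..} - {6, 12}" using N J by (auto simp: K_def)
  then obtain p where p: "prime p" "p dvd fib N" "\<And>m. 0 < m \<Longrightarrow> m < N \<Longrightarrow> \<not> p dvd fib m"
    using fib_primitive_prime[of N] by auto
  have dvdP: "p dvd P S \<longleftrightarrow> N \<in> S" if S: "S \<subseteq> K" for S
  proof
    have fin: "finite S" using S K finite_subset by blast
    assume "p dvd P S"
    then obtain i where i: "i \<in> S" "p dvd fib i ^ nat \<bar>c i\<bar>"
      unfolding P_def using p(1) fin by (auto simp: prime_dvd_prod_iff)
    hence "p dvd fib i" using p(1) prime_dvd_power by blast
    moreover have "0 < i" "i \<le> N" using i S N J by (auto simp: K_def)
    ultimately have "i = N" using p(3) by (metis le_neq_implies_less)
    thus "N \<in> S" using i by simp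
  next
    assume "N \<in> S"
    moreover have "finite S" using S K finite_subset by blast
    ultimately have "fib N ^ nat \<bar>c N\<bar> dvd P S" unfolding P_def by (intro dvd_prodI)
    moreover have "nat \<bar>c N\<bar> > 0" using N by (auto simp: K_def)
    ultimately show "p dvd P S" using p(2) by (meson dvd_power dvd_trans dvd_power_same)
  qed
  have "A \<subseteq> K" "B \<subseteq> K" using AB(4) by simp_all
  hence "N \<in> A \<longleftrightarrow> N \<in> B" using dvdP eq by metis
  thus False using AB(3,4) N(1) by blast
qed

lemma norm_cis_minus_1_le: "norm (cis x - 1) \<le> \<bar>x\<bar>"
proof -
  have "norm (cis x - 1) = 2 * \<bar>sin (x / 2)\<bar>" using dist_exp_i_1[of x] by (simp add: cis_conv_exp)
  also have "\<dots> \<le> 2 * \<bar>x / 2\<bar>" using abs_sin_x_le_abs_x[of "x / 2"] by linarith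
  finally show ?thesis by simp
qed

text \<open>Dividing the logarithms by 2 pi turns phases into fractional parts, to which Kronecker's
  theorem applies; \<open>e\<close> enumerates the free indices, since that theorem is stated over
  an initial segment of the naturals.\<close>

lemma fib_phases_relatively_dense:
  fixes w :: "nat \<Rightarrow> real"
  assumes w: "\<And>n. w n = 1 \<or> w n = -1" and "\<epsilon> > 0"
  shows "\<exists>L>0. \<forall>a. \<exists>t\<in>{a<..<a + L}. \<forall>n\<in>{3..N} - {6, 12}.
           norm (cis (- (t * ln (real (fib n)))) - of_real (w n)) < \<epsilon>"
proof -
  define I where "I = {3..N} - {6, 12}"
  have "finite I" by (simp add: I_def)
  obtain e where e: "bij_betw e {..<card I} I"
    using ex_bij_betw_nat_finite[OF \<open>finite I\<close>] by (auto simp: atLeast0LessThan)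
  define \<theta> where "\<theta> i = ln (real (fib (e i))) / (2 * pi)" for i
  interpret M: Modules.module "(\<lambda>r. (*) (real_of_int r))"
    by (simp add: Modules.module.intro distrib_left mult.commute)
  have inj_e: "inj_on e {..<card I}" using e by (simp add: bij_betw_def)
  have eI: "e i \<in> I" if "i < card I" for i using e that by (auto simp: bij_betw_def)
  \<comment> \<open>Independence concerns the set of values and does not see repetitions, so
    distinctness needs its own argument: equal values would be the relation with coefficients 1 and
    -1.\<close>
  have inj: "inj_on \<theta> {..<card I}"
  proof (rule inj_onI)
    fix i j assume ij: "i \<in> {..<card I}" "j \<in> {..<card I}" "\<theta> i = \<theta> j"
    have "e i = e j"
    proof (rule ccontr)
      assume ne: "e i \<noteq> e j"
      define c where "c = (\<lambda>k. if k = e i then 1 else (-1::int))"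
      have "(\<Sum>k\<in>{e i, e j}. of_int (c k) * ln (real (fib k))) = 0"
        using ij(3) ne by (simp add: \<theta>_def c_def)
      moreover have "{e i, e j} \<subseteq> {3..} - {6, 12}" using eI ij by (auto simp: I_def)
      ultimately have "c (e i) = 0" by (intro ln_fib_linear_independent[of "{e i, e j}"]) auto
      thus False by (simp add: c_def)
    qed
    thus "i = j" using inj_e ij by (auto dest: inj_onD)
  qed
  have indep: "M.independent (\<theta> ` {..<card I})"
    unfolding M.independent_explicit_module
  proof (intro allI impI)
    fix t :: "real set" and u v
    assume t: "finite t" "t \<subseteq> \<theta> ` {..<card I}" and s: "(\<Sum>v\<in>t. real_of_int (u v) * v) = 0" and v: "v \<in> t"
    define S where "S = {i\<in>{..<card I}. \<theta> i \<in> t}"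
    have tS: "t = \<theta> ` S" using t by (auto simp: S_def)
    have injS: "inj_on \<theta> S" "inj_on e S" using inj inj_e by (auto simp: S_def inj_on_def)
    obtain i where i: "i \<in> S" "v = \<theta> i" using v tS by blast
    define c where "c n = u (\<theta> (the_inv_into {..<card I} e n))" for n
    have ce: "c (e i) = u (\<theta> i)" if "i < card I" for i
      using that inj_e by (simp add: c_def the_inv_into_f_f)
    have "0 = 2 * pi * (\<Sum>i\<in>S. real_of_int (u (\<theta> i)) * \<theta> i)"
      using s unfolding tS by (subst (asm) sum.reindex[OF injS(1)]) simp
    also have "\<dots> = (\<Sum>i\<in>S. of_int (c (e i)) * ln (real (fib (e i))))"
      unfolding sum_distrib_left by (rule sum.cong) (auto simp: ce S_def \<theta>_def)
    also have "\<dots> = (\<Sum>n\<in>e ` S. of_int (c n) * ln (real (fib n)))"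
      using injS(2) by (subst sum.reindex) auto
    finally have "(\<Sum>n\<in>e ` S. of_int (c n) * ln (real (fib n))) = 0" by simp
    moreover have "e ` S \<subseteq> {3..} - {6, 12}" using eI by (auto simp: S_def I_def)
    moreover have "finite (e ` S)" by (simp add: S_def)
    ultimately have "c (e i) = 0" using i by (intro ln_fib_linear_independent[of "e ` S" c]) auto
    thus "u v = 0" using ce i by (auto simp: S_def)
  qed
  \<comment> \<open>The sign -1 is half a turn.\<close>
  define \<alpha> where "\<alpha> i = (if w (e i) = 1 then 0 else 1 / 2 :: real)" for i
  obtain L where L: "L > 0" "\<And>a \<alpha>. \<exists>t\<in>{a<..<a + L}. \<exists>h. \<forall>i<card I. \<bar>t * \<theta> i - of_int (h i) - \<alpha> i\<bar> < \<epsilon> / (2 * pi)"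
    using Kronecker_relatively_dense[OF indep inj, of "\<epsilon> / (2 * pi)"] \<open>\<epsilon> > 0\<close> by auto
  show ?thesis
  proof (intro exI[of _ L] conjI allI)
    fix a
    obtain t h where t: "t \<in> {a<..<a + L}" and h: "\<And>i. i < card I \<Longrightarrow> \<bar>t * \<theta> i - of_int (h i) - \<alpha> i\<bar> < \<epsilon> / (2 * pi)"
      using L(2)[of a \<alpha>] by blast
    show "\<exists>t\<in>{a<..<a + L}. \<forall>n\<in>{3..N} - {6, 12}. norm (cis (- (t * ln (real (fib n)))) - of_real (w n)) < \<epsilon>"
    proof (intro bexI[OF _ t] ballI)
      fix n assume "n \<in> {3..N} - {6, 12}"
      then obtain i where i: "i < card I" "n = e i"
        using e unfolding bij_betw_def I_def[symmetric] by blast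
      define d where "d = t * \<theta> i - of_int (h i) - \<alpha> i"
      have eq: "t * ln (real (fib n)) = 2 * pi * of_int (h i) + 2 * pi * \<alpha> i + 2 * pi * d"
        by (simp add: d_def \<theta>_def i field_simps)
      have c1: "cis (- (2 * pi * of_int (h i))) = 1"
        using cis_multiple_2pi[of "of_int (- h i)"] by simp
      have c2: "cis (- (2 * pi * \<alpha> i)) = of_real (w n)"
        using w[of n] by (auto simp: \<alpha>_def i complex_eq_iff)
      have "cis (- (t * ln (real (fib n)))) = cis (- (2 * pi * of_int (h i)) + - (2 * pi * \<alpha> i) + - (2 * pi * d))"
        unfolding eq by (rule arg_cong) simp
      also have "\<dots> = of_real (w n) * cis (- (2 * pi * d))"
        unfolding cis_mult[symmetric] c1 c2 by simp
      finally have "cis (- (t * ln (real (fib n)))) - of_real (w n) = of_real (w n) * (cis (- (2 * pi * d)) - 1)"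
        by (simp add: right_diff_distrib)
      moreover have "\<bar>w n\<bar> = 1" using w[of n] by auto
      ultimately have "norm (cis (- (t * ln (real (fib n)))) - of_real (w n)) \<le> \<bar>2 * pi * d\<bar>"
        using norm_cis_minus_1_le[of "- (2 * pi * d)"] by (simp add: norm_mult)
      also have "\<dots> = 2 * pi * \<bar>d\<bar>" by (simp add: abs_mult)
      also have "\<dots> < \<epsilon>" using h[OF i(1)] unfolding d_def[symmetric] by (simp add: field_simps)
      finally show "norm (cis (- (t * ln (real (fib n)))) - of_real (w n)) < \<epsilon>" .
    qed
  qed (use L in auto)
qed

section \<open>Zeros of twisted series and of their vertical shifts\<close>

text \<open>These are the limits of vertical shifts of the zeta function when the phases approach
  signs. The constant twist 1 returns \<open>fib_zeta\<close>, so that convergence, holomorphy and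
  nonvanishing at 2 are shown once for both.\<close>

definition twisted_fib_zeta :: "(nat \<Rightarrow> real) \<Rightarrow> complex \<Rightarrow> complex" where
  "twisted_fib_zeta w s = (\<Sum>n. of_real (w (Suc n)) * of_nat (fib (Suc n)) powr (- s))"

lemma fib_zeta_eq_twisted: "fib_zeta = twisted_fib_zeta (\<lambda>_. 1)"
  by (simp add: fun_eq_iff fib_zeta_def twisted_fib_zeta_def)

lemma fib_Suc_pos: "fib (Suc n) > 0"
  by (rule fib_neq_0_nat) simp

lemma fib_Suc_ge_power: "(3 / 2) ^ n / 2 \<le> real (fib (Suc n))"
proof (induction n rule: fib.induct)
  case (3 n)
  have "(3 / 2 :: real) ^ Suc (Suc n) / 2 \<le> (3 / 2) ^ Suc n / 2 + (3 / 2) ^ n / 2" by simp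
  also have "\<dots> \<le> real (fib (Suc (Suc n))) + real (fib (Suc n))" using 3 by (rule add_mono)
  finally show ?case by simp
qed simp_all

lemma fib_powr_le_geometric:
  assumes "x > 0"
  shows "real (fib (Suc n)) powr - x \<le> 2 powr x * ((2 / 3) powr x) ^ n"
proof -
  have "real (fib (Suc n)) powr - x \<le> ((3 / 2) ^ n / 2) powr - x"
    using assms fib_Suc_ge_power[of n] by (intro powr_mono2') auto
  also have "\<dots> = 2 powr x * ((2 / 3) ^ n) powr x"
    by (simp add: powr_minus powr_divide powr_mult power_divide field_simps)
  also have "((2 / 3 :: real) ^ n) powr x = ((2 / 3) powr x) ^ n"
    by (simp add: powr_powr powr_realpow[symmetric] mult.commute)
  finally show ?thesis .
qed

lemma summable_fib_powr:
  assumes "x > 0"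
  shows "summable (\<lambda>n. real (fib (Suc n)) powr - x)"
proof (rule summable_comparison_test')
  have "(2 / 3 :: real) powr x < 1" using assms powr_less_mono2[of x "2 / 3" 1] by simp
  thus "summable (\<lambda>n. 2 powr x * ((2 / 3) powr x) ^ n)" by (intro summable_mult summable_geometric) simp
qed (use fib_powr_le_geometric[OF assms] in simp)

lemma norm_of_nat_powr:
  "norm (of_nat k powr (- s) :: complex) = real k powr - Re s"
  using norm_powr_real_powr[of "of_nat k" "- s"] by simp

lemma norm_twisted_term_le:
  assumes "\<bar>w (Suc n)\<bar> \<le> 1" "x \<le> Re s"
  shows "norm (of_real (w (Suc n)) * of_nat (fib (Suc n)) powr (- s) :: complex) \<le> real (fib (Suc n)) powr - x"
proof -
  have "real (fib (Suc n)) powr - Re s \<le> real (fib (Suc n)) powr - x"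
    using assms(2) fib_Suc_pos[of n] by (intro powr_mono) auto
  thus ?thesis using assms(1) mult_mono[of "\<bar>w (Suc n)\<bar>" 1] by (simp only: norm_mult norm_of_nat_powr norm_of_real) simp
qed

lemma summable_twisted_term:
  assumes "\<And>n. \<bar>w n\<bar> \<le> 1" "Re s > 0"
  shows "summable (\<lambda>n. of_real (w (Suc n)) * of_nat (fib (Suc n)) powr (- s) :: complex)"
  by (rule summable_comparison_test'[OF summable_fib_powr[OF assms(2)]])
     (use norm_twisted_term_le[of w _ "Re s" s] assms in simp)

lemma twisted_fib_zeta_holomorphic:
  assumes w: "\<And>n. \<bar>w n\<bar> \<le> 1"
  shows "twisted_fib_zeta w holomorphic_on {s. Re s > 0}"
proof (rule holomorphic_uniform_sequence)
  show "open {s. Re s > 0}" by (rule open_halfspace_Re_gt)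
  show "(\<lambda>s. \<Sum>n<N. of_real (w (Suc n)) * of_nat (fib (Suc n)) powr (- s)) holomorphic_on {s. Re s > 0}" for N
    using fib_Suc_pos by (intro holomorphic_intros) auto
  fix s :: complex assume s: "s \<in> {s. Re s > 0}"
  define d where "d = Re s / 2"
  have d: "d > 0" using s by (simp add: d_def)
  have ge: "d \<le> Re z" if "z \<in> cball s d" for z
    using that abs_Re_le_cmod[of "s - z"] by (simp add: dist_norm d_def)
  have "uniform_limit (cball s d) (\<lambda>N s. \<Sum>n<N. of_real (w (Suc n)) * of_nat (fib (Suc n)) powr (- s))
      (twisted_fib_zeta w) sequentially"
    unfolding twisted_fib_zeta_def
    by (rule Weierstrass_m_test[OF _ summable_fib_powr[OF d]]) (use norm_twisted_term_le w ge in blast)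
  moreover have "cball s d \<subseteq> {s. Re s > 0}" using ge d by fastforce
  ultimately show "\<exists>d>0. cball s d \<subseteq> {s. Re s > 0} \<and>
      uniform_limit (cball s d) (\<lambda>N s. \<Sum>n<N. of_real (w (Suc n)) * of_nat (fib (Suc n)) powr (- s)) (twisted_fib_zeta w) sequentially"
    using d by blast
qed

text \<open>A witness that the function is not identically zero, from which isolated zeros and
  finite orders follow. At s = 2 the first two terms give 2, and the rest is at most 64/45 by the
  geometric bound.\<close>

lemma twisted_fib_zeta_2_nonzero:
  assumes w: "\<And>n. \<bar>w n\<bar> \<le> 1" and w12: "w 1 = 1" "w 2 = 1"
  shows "twisted_fib_zeta w 2 \<noteq> 0"
proof
  assume z: "twisted_fib_zeta w 2 = 0"
  define f where "f n = (of_real (w (Suc n)) * of_nat (fib (Suc n)) powr (- 2) :: complex)" for n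
  have sf: "summable f" unfolding f_def by (rule summable_twisted_term) (use w in auto)
  have nf: "norm (f n) \<le> 4 * (4 / 9) ^ n" for n
  proof -
    have "norm (f n) \<le> real (fib (Suc n)) powr - 2"
      unfolding f_def by (rule norm_twisted_term_le) (use w in auto)
    also have "\<dots> \<le> 2 powr 2 * ((2 / 3) powr 2) ^ n" by (rule fib_powr_le_geometric) simp
    finally show ?thesis by (simp add: power2_eq_square)
  qed
  have "(\<Sum>n. f n) = (\<Sum>n. f (n + 2)) + (\<Sum>n<2. f n)" by (rule suminf_split_initial_segment[OF sf])
  also have "(\<Sum>n<2. f n) = 2" using w12 by (simp add: f_def numeral_2_eq_2)
  finally have eq: "(\<Sum>n. f (n + 2)) = - 2" using z unfolding twisted_fib_zeta_def f_def[symmetric]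
    by (simp add: eq_neg_iff_add_eq_0)
  have gs: "(\<lambda>n. 4 * (4 / 9) ^ (n + 2)) sums (4 * (4 / 9) ^ 2 * (1 / (1 - 4 / 9 :: real)))"
  proof -
    have "(\<lambda>n. 4 * (4 / 9 :: real) ^ (n + 2)) = (\<lambda>n. 4 * (4 / 9) ^ 2 * (4 / 9) ^ n)"
      by (simp add: power_add fun_eq_iff power2_eq_square)
    thus ?thesis using sums_mult[OF geometric_sums[of "4 / 9 :: real"], of "4 * (4 / 9) ^ 2"] by simp
  qed
  have "norm (\<Sum>n. f (n + 2)) \<le> (\<Sum>n. 4 * (4 / 9) ^ (n + 2))"
    by (rule norm_suminf_le[OF nf sums_summable[OF gs]])
  also have "\<dots> = 4 * (4 / 9) ^ 2 * (1 / (1 - 4 / 9))" using gs by (rule sums_unique[symmetric])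
  also have "\<dots> < 2" by (simp add: power2_eq_square)
  finally show False unfolding eq by simp
qed

section \<open>Phases under vertical shifts, including the dependent ones\<close>

lemma norm_power_diff_le:
  fixes z u :: complex
  assumes "norm z = 1" "norm u = 1"
  shows "norm (z ^ k - u ^ k) \<le> real k * norm (z - u)"
proof (induction k)
  case (Suc k)
  have "z ^ Suc k - u ^ Suc k = z * (z ^ k - u ^ k) + (z - u) * u ^ k" by (simp add: algebra_simps)
  hence "norm (z ^ Suc k - u ^ Suc k) \<le> norm (z * (z ^ k - u ^ k)) + norm ((z - u) * u ^ k)"
    using norm_triangle_ineq by metis
  also have "\<dots> = norm (z ^ k - u ^ k) + norm (z - u)" using assms by (simp add: norm_mult norm_power)
  finally show ?case using Suc by (simp add: algebra_simps)
qed simp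

definition fib_phase :: "real \<Rightarrow> nat \<Rightarrow> complex" where
  "fib_phase t n = cis (- (t * ln (real (fib n))))"

lemma norm_fib_phase [simp]: "norm (fib_phase t n) = 1"
  by (simp add: fib_phase_def)

lemma fib_6: "fib 6 = fib 3 ^ 3" and fib_12: "fib 12 = fib 3 ^ 4 * fib 4 ^ 2"
  by (simp_all add: fib_small fib_numeral_gen_fib gen_fib_numeral)

lemma fib_phase_6: "fib_phase t 6 = fib_phase t 3 ^ 3"
proof -
  have "ln (real (fib 6)) = 3 * ln (real (fib 3))"
    unfolding fib_6 of_nat_power by (subst ln_realpow) (auto simp: fib_small)
  thus ?thesis by (simp add: fib_phase_def Complex.DeMoivre mult_ac)
qed

lemma fib_phase_12: "fib_phase t 12 = fib_phase t 3 ^ 4 * fib_phase t 4 ^ 2"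
proof -
  have "ln (real (fib 12)) = ln (real (fib 3) ^ 4) + ln (real (fib 4) ^ 2)"
    unfolding fib_12 of_nat_power of_nat_mult by (intro ln_mult_pos) (auto simp: fib_small)
  also have "\<dots> = 4 * ln (real (fib 3)) + 2 * ln (real (fib 4))"
    by (subst (1 2) ln_realpow) (auto simp: fib_small)
  finally show ?thesis by (simp add: fib_phase_def Complex.DeMoivre cis_mult algebra_simps)
qed

lemma fib_powr_shift:
  assumes "n > 0"
  shows "of_nat (fib n) powr (- (s + \<i> * of_real t)) = of_nat (fib n) powr (- s) * fib_phase t n"
proof -
  have nz: "(of_nat (fib n) :: complex) \<noteq> 0" using fib_neq_0_nat[OF assms] by simp
  have Ln: "Ln (of_nat (fib n)) = of_real (ln (real (fib n)))"
    using fib_neq_0_nat[OF assms] by (metis Ln_of_real of_nat_0_less_iff of_real_of_nat_eq)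
  have "of_nat (fib n) powr (- (s + \<i> * of_real t)) = of_nat (fib n) powr (- s) * of_nat (fib n) powr (- (\<i> * of_real t))"
    by (simp add: powr_add[symmetric])
  also have "of_nat (fib n) powr (- (\<i> * of_real t)) = fib_phase t n"
    using nz by (simp add: powr_def Ln fib_phase_def cis_conv_exp mult_ac)
  finally show ?thesis .
qed

text \<open>The phases at 6 and 12 are monomials of degree 3 and 4 + 2 = 6 in those at 3 and 4, so
  accuracy \<epsilon>/6 there suffices. The bound \<open>max N 4\<close> ensures that 3 and 4 are
  approximated even when \<open>N\<close> is smaller.\<close>

lemma fib_phases_all_relatively_dense:
  fixes w :: "nat \<Rightarrow> real"
  assumes w: "\<And>n. w n = 1 \<or> w n = -1" and w0: "w 1 = 1" "w 2 = 1" "w 6 = w 3 ^ 3" "w 12 = w 3 ^ 4 * w 4 ^ 2"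
    and "\<epsilon> > 0"
  shows "\<exists>L>0. \<forall>a. \<exists>t\<in>{a<..<a + L}. \<forall>n\<in>{1..N}. norm (fib_phase t n - of_real (w n)) < \<epsilon>"
proof -
  obtain L where L: "L > 0" "\<And>a. \<exists>t\<in>{a<..<a + L}. \<forall>n\<in>{3..max N 4} - {6, 12}.
      norm (fib_phase t n - of_real (w n)) < \<epsilon> / 6"
    using fib_phases_relatively_dense[of w "\<epsilon> / 6" "max N 4"] w \<open>\<epsilon> > 0\<close> unfolding fib_phase_def by auto
  show ?thesis
  proof (intro exI[of _ L] conjI allI L(1))
    fix a
    obtain t where t: "t \<in> {a<..<a + L}" and *: "\<And>n. n \<in> {3..max N 4} - {6, 12} \<Longrightarrow>
      norm (fib_phase t n - of_real (w n)) < \<epsilon> / 6" using L(2)[of a] by blast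
    have nw: "norm (of_real (w n) :: complex) = 1" for n using w[of n] by auto
    have d3: "norm (fib_phase t 3 - of_real (w 3)) < \<epsilon> / 6" and d4: "norm (fib_phase t 4 - of_real (w 4)) < \<epsilon> / 6"
      by (intro *; simp)+
    show "\<exists>t\<in>{a<..<a + L}. \<forall>n\<in>{1..N}. norm (fib_phase t n - of_real (w n)) < \<epsilon>"
    proof (intro bexI[OF _ t] ballI)
      fix n assume n: "n \<in> {1..N}"
      then consider "n = 1" | "n = 2" | "n = 6" | "n = 12" | "n \<in> {3..max N 4} - {6, 12}" by force
      thus "norm (fib_phase t n - of_real (w n)) < \<epsilon>"
      proof cases
        case 3
        have "norm (fib_phase t 3 ^ 3 - of_real (w 3) ^ 3) \<le> real 3 * norm (fib_phase t 3 - of_real (w 3))"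
          using nw by (intro norm_power_diff_le) auto
        thus ?thesis using d3 \<open>\<epsilon> > 0\<close> by (simp add: 3 fib_phase_6 w0)
      next
        case 4
        have 1: "norm (fib_phase t 3 ^ 4 - of_real (w 3) ^ 4) \<le> real 4 * norm (fib_phase t 3 - of_real (w 3))"
          using nw by (intro norm_power_diff_le) auto
        have 2: "norm (fib_phase t 4 ^ 2 - of_real (w 4) ^ 2) \<le> real 2 * norm (fib_phase t 4 - of_real (w 4))"
          using nw by (intro norm_power_diff_le) auto
        have "fib_phase t 12 - of_real (w 12) = (fib_phase t 3 ^ 4 - of_real (w 3) ^ 4) * fib_phase t 4 ^ 2
            + of_real (w 3) ^ 4 * (fib_phase t 4 ^ 2 - of_real (w 4) ^ 2)"
          by (simp add: fib_phase_12 w0 algebra_simps)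
        hence "norm (fib_phase t 12 - of_real (w 12)) \<le> norm ((fib_phase t 3 ^ 4 - of_real (w 3) ^ 4) * fib_phase t 4 ^ 2)
            + norm (of_real (w 3) ^ 4 * (fib_phase t 4 ^ 2 - of_real (w 4) ^ 2))"
          using norm_triangle_ineq by metis
        also have "\<dots> = norm (fib_phase t 3 ^ 4 - of_real (w 3) ^ 4) + norm (fib_phase t 4 ^ 2 - of_real (w 4) ^ 2)"
          unfolding norm_mult norm_power nw norm_fib_phase by simp
        finally show ?thesis using 1 2 d3 d4 unfolding 4 by simp
      next
        case 5
        thus ?thesis using *[OF 5] \<open>\<epsilon> > 0\<close> by simp
      qed (use \<open>\<epsilon> > 0\<close> w0 in \<open>simp_all add: fib_phase_def\<close>)
    qed
  qed
qed

text \<open>A Hurwitz argument: on a small circle around \<sigma> the twisted series stays at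
  distance at least \<open>m\<close> from 0. A shift \<open>g\<close> within m/2 of it on the closed
  disc is smaller at the centre than anywhere on the circle, and so has a zero inside.\<close>

theorem fib_zeta_zeros_near_twisted_zero:
  fixes w :: "nat \<Rightarrow> real"
  assumes w: "\<And>n. w n = 1 \<or> w n = -1" and w0: "w 1 = 1" "w 2 = 1" "w 6 = w 3 ^ 3" "w 12 = w 3 ^ 4 * w 4 ^ 2"
    and zero: "twisted_fib_zeta w (of_real \<sigma>) = 0" and \<sigma>: "\<sigma> > 0" and \<epsilon>: "\<epsilon> > 0"
  shows "\<exists>L>0. \<forall>a. \<exists>\<rho>\<in>fib_zeta_zeros. Im \<rho> \<in> {a<..<a + L} \<and> \<bar>Re \<rho> - \<sigma>\<bar> < \<epsilon>"
proof -
  define H where "H = {s. Re s > 0}"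
  define f where "f = twisted_fib_zeta w"
  have w1: "\<bar>w n\<bar> \<le> 1" for n using w[of n] by auto
  have holf: "f holomorphic_on H" unfolding f_def H_def by (rule twisted_fib_zeta_holomorphic[OF w1])
  have holz: "fib_zeta holomorphic_on H"
    unfolding fib_zeta_eq_twisted H_def by (rule twisted_fib_zeta_holomorphic) simp
  have H: "open H" "connected H" unfolding H_def
    by (simp_all add: open_halfspace_Re_gt convex_connected convex_halfspace_Re_gt)
  have "f 2 \<noteq> 0" unfolding f_def by (rule twisted_fib_zeta_2_nonzero[OF w1 w0(1,2)])
  moreover have "of_real \<sigma> \<in> H" "2 \<in> H" using \<sigma> by (simp_all add: H_def)
  ultimately obtain r where r: "r > 0" "ball (of_real \<sigma>) r \<subseteq> H" "\<And>z. z \<in> ball (of_real \<sigma>) r - {of_real \<sigma>} \<Longrightarrow> f z \<noteq> 0"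
    using isolated_zeros[OF holf H, of "of_real \<sigma>" 2] zero unfolding f_def by metis
  \<comment> \<open>The three bounds keep other zeros of the twisted series off the circle, the real
    part within \<epsilon> of \<sigma>, and the disc inside the half-plane of convergence.\<close>
  define \<delta> where "\<delta> = min r (min \<epsilon> \<sigma>) / 2"
  have \<delta>: "\<delta> > 0" "\<delta> < r" "\<delta> < \<epsilon>" "\<delta> < \<sigma>" using r \<epsilon> \<sigma> by (auto simp: \<delta>_def min_def)
  define y where "y = \<sigma> - \<delta>"
  have y: "y > 0" using \<delta> by (simp add: y_def)
  have Re_ge: "Re z \<ge> y" if "z \<in> cball (of_real \<sigma>) \<delta>" for z
    using that abs_Re_le_cmod[of "of_real \<sigma> - z"] by (simp add: dist_norm y_def)
  have cont: "continuous_on (sphere (of_real \<sigma>) \<delta>) (\<lambda>z. norm (f z))"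
    using \<delta> r(2) by (intro continuous_on_norm holomorphic_on_imp_continuous_on holomorphic_on_subset[OF holf]) auto
  obtain z0 where z0: "z0 \<in> sphere (of_real \<sigma>) \<delta>" "\<And>z. z \<in> sphere (of_real \<sigma>) \<delta> \<Longrightarrow> norm (f z0) \<le> norm (f z)"
    using continuous_attains_inf[OF compact_sphere _ cont] \<delta>(1) by auto
  define m where "m = norm (f z0)"
  have "z0 \<in> ball (of_real \<sigma>) r - {of_real \<sigma>}" using z0(1) \<delta> by auto
  hence m: "m > 0" unfolding m_def using r(3) by simp
  define b where "b n = real (fib (Suc n)) powr - y" for n
  have sb: "summable b" unfolding b_def by (rule summable_fib_powr[OF y])
  have b0: "b n \<ge> 0" for n by (simp add: b_def)
  define B where "B = (\<Sum>n. b n) + 1"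
  have B: "B > 0" unfolding B_def using suminf_nonneg[OF sb] b0 by (simp add: add_nonneg_pos)
  have "0 < m / 8" using m by simp
  then obtain N where "norm (\<Sum>n. b (n + N)) < m / 8" using suminf_exist_split[OF _ sb] by blast
  hence N: "(\<Sum>n. b (n + N)) < m / 8" by simp
  \<comment> \<open>The error m/2 is split evenly: the tail, where phases differ by at most 2, gives
    less than 2 * m/8, and the first \<open>N\<close> terms at most B * \<eta>.\<close>
  define \<eta> where "\<eta> = m / (4 * B)"
  have \<eta>: "\<eta> > 0" using m B by (simp add: \<eta>_def)
  obtain L where L: "L > 0" "\<And>a. \<exists>t\<in>{a<..<a + L}. \<forall>n\<in>{1..N}. norm (fib_phase t n - of_real (w n)) < \<eta>"
    using fib_phases_all_relatively_dense[OF w w0 \<eta>, of N] by blast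
  show ?thesis
  proof (intro exI[of _ "L + 2 * \<delta>"] conjI allI)
    show "L + 2 * \<delta> > 0" using L \<delta> by simp
    fix a
    \<comment> \<open>The zero may lie up to \<delta> above or below height \<open>t\<close>, hence
      the margin \<delta> at both ends of the window.\<close>
    obtain t where t: "t \<in> {a + \<delta><..<a + \<delta> + L}" "\<And>n. n \<in> {1..N} \<Longrightarrow> norm (fib_phase t n - of_real (w n)) < \<eta>"
      using L(2)[of "a + \<delta>"] by blast
    define g where "g z = fib_zeta (z + \<i> * of_real t)" for z
    have close: "norm (g z - f z) < m / 2" if z: "z \<in> cball (of_real \<sigma>) \<delta>" for z
    proof -
      define u where "u n = (of_nat (fib (Suc n)) powr (- z) * (fib_phase t (Suc n) - of_real (w (Suc n))) :: complex)" for n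
      have Rez: "Re z > 0" using Re_ge[OF z] y by linarith
      have "g z = (\<Sum>n. of_nat (fib (Suc n)) powr (- z) * fib_phase t (Suc n))"
        unfolding g_def fib_zeta_def by (simp only: fib_powr_shift[OF zero_less_Suc])
      moreover have "summable (\<lambda>n. of_nat (fib (Suc n)) powr (- z) * fib_phase t (Suc n))"
        using summable_twisted_term[of "\<lambda>_. 1" "z + \<i> * of_real t"] Rez
        by (simp only: fib_powr_shift[OF zero_less_Suc]) simp
      ultimately have gf: "g z - f z = (\<Sum>n. u n)"
        using summable_twisted_term[of w z, OF w1 Rez] unfolding f_def twisted_fib_zeta_def u_def
        by (simp add: suminf_diff algebra_simps)
      have ub: "norm (u n) \<le> b n * norm (fib_phase t (Suc n) - of_real (w (Suc n)))" for n
        using powr_mono[of "- Re z" "- y" "real (fib (Suc n))"] Re_ge[OF z] fib_Suc_pos[of n]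
        unfolding u_def b_def norm_mult norm_of_nat_powr by (intro mult_right_mono) auto
      have u2: "norm (u n) \<le> 2 * b n" for n
      proof -
        have "norm (fib_phase t (Suc n) - of_real (w (Suc n))) \<le> 1 + \<bar>w (Suc n)\<bar>"
          using norm_triangle_ineq4[of "fib_phase t (Suc n)" "of_real (w (Suc n))"] by simp
        also have "\<dots> \<le> 2" using w1[of "Suc n"] by simp
        finally have "b n * norm (fib_phase t (Suc n) - of_real (w (Suc n))) \<le> b n * 2"
          using b0 by (intro mult_left_mono)
        thus ?thesis using ub[of n] by simp
      qed
      have su: "summable (\<lambda>n. norm (u n))"
        by (rule summable_comparison_test'[OF summable_mult[OF sb, of 2]]) (use u2 in simp)
      have "norm (g z - f z) \<le> (\<Sum>n. norm (u n))" unfolding gf by (rule summable_norm[OF su])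
      also have "\<dots> = (\<Sum>n. norm (u (n + N))) + (\<Sum>n<N. norm (u n))"
        by (rule suminf_split_initial_segment[OF su])
      also have "(\<Sum>n. norm (u (n + N))) \<le> (\<Sum>n. 2 * b (n + N))"
        using u2 by (intro suminf_le summable_mult summable_ignore_initial_segment[OF su]
            summable_ignore_initial_segment[OF sb]) auto
      also have "\<dots> = 2 * (\<Sum>n. b (n + N))" by (rule suminf_mult[OF summable_ignore_initial_segment[OF sb]])
      also have "\<dots> < m / 4" using N by simp
      also have "(\<Sum>n<N. norm (u n)) \<le> (\<Sum>n<N. b n * \<eta>)"
      proof (intro sum_mono order_trans[OF ub] mult_left_mono)
        fix n assume "n \<in> {..<N}"
        thus "norm (fib_phase t (Suc n) - of_real (w (Suc n))) \<le> \<eta>" using t(2)[of "Suc n"] by (simp add: less_imp_le)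
      qed (rule b0)
      also have "\<dots> = (\<Sum>n<N. b n) * \<eta>" by (simp add: sum_distrib_right)
      also have "(\<Sum>n<N. b n) \<le> B" unfolding B_def using sum_le_suminf[OF sb, of "{..<N}"] b0 by simp
      hence "(\<Sum>n<N. b n) * \<eta> \<le> B * \<eta>" using \<eta> by (intro mult_right_mono) auto
      also have "B * \<eta> = m / 4" using B by (simp add: \<eta>_def)
      finally show ?thesis by simp
    qed
    have sub: "z + \<i> * of_real t \<in> H" if "z \<in> cball (of_real \<sigma>) \<delta>" for z
      using Re_ge[OF that] y by (simp add: H_def)
    have holg: "g holomorphic_on cball (of_real \<sigma>) \<delta>"
    proof -
      have "(\<lambda>z. z + \<i> * of_real t) holomorphic_on cball (of_real \<sigma>) \<delta>" by (intro holomorphic_intros)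
      moreover have "(\<lambda>z. z + \<i> * of_real t) ` cball (of_real \<sigma>) \<delta> \<subseteq> H" using sub by blast
      ultimately show ?thesis
        unfolding g_def using holomorphic_on_compose_gen[OF _ holz] by (simp add: o_def)
    qed
    have "\<exists>z\<in>ball (of_real \<sigma>) \<delta>. g z = 0"
    proof (rule holomorphic_contract_to_zero[of "of_real \<sigma>" \<delta> g])
      show "continuous_on (cball (of_real \<sigma>) \<delta>) g" using holg by (rule holomorphic_on_imp_continuous_on)
      show "g holomorphic_on ball (of_real \<sigma>) \<delta>" using holg by (rule holomorphic_on_subset) auto
      show "0 < \<delta>" by (rule \<delta>(1))
      fix z :: complex assume z: "norm (of_real \<sigma> - z) = \<delta>"
      have "norm (g (of_real \<sigma>)) < m / 2"
        using close[of "of_real \<sigma>"] \<delta> zero unfolding f_def by simp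
      moreover have "m \<le> norm (f z)" using z0(2)[of z] z by (simp add: m_def dist_norm)
      moreover have "norm (g z - f z) < m / 2" using close[of z] z by (simp add: dist_norm)
      moreover have "norm (f z) \<le> norm (g z) + norm (g z - f z)"
        using norm_triangle_ineq4[of "g z" "g z - f z"] by simp
      ultimately show "norm (g (of_real \<sigma>)) < norm (g z)" by linarith
    qed blast
    then obtain z where z: "z \<in> ball (of_real \<sigma>) \<delta>" "g z = 0" by blast
    show "\<exists>\<rho>\<in>fib_zeta_zeros. Im \<rho> \<in> {a<..<a + (L + 2 * \<delta>)} \<and> \<bar>Re \<rho> - \<sigma>\<bar> < \<epsilon>"
    proof (intro bexI[of _ "z + \<i> * of_real t"] conjI)
      have "norm (of_real \<sigma> - z) < \<delta>" using z(1) by (simp add: dist_norm)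
      hence "\<bar>\<sigma> - Re z\<bar> < \<delta>" "\<bar>Im z\<bar> < \<delta>"
        using abs_Re_le_cmod[of "of_real \<sigma> - z"] abs_Im_le_cmod[of "of_real \<sigma> - z"] by simp_all
      thus "Im (z + \<i> * of_real t) \<in> {a<..<a + (L + 2 * \<delta>)}" "\<bar>Re (z + \<i> * of_real t) - \<sigma>\<bar> < \<epsilon>"
        using t(1) \<delta> by auto
      show "z + \<i> * of_real t \<in> fib_zeta_zeros"
        using z sub[of z] by (auto simp: fib_zeta_zeros_def g_def H_def)
    qed
  qed
qed

section \<open>Signs with a prescribed zero\<close>

text \<open>Kakeya's greedy choice: always step towards \<open>0\<close>. The hypothesis \<open>c n \<le> \<Sum> c (k + Suc n)\<close> keeps
  the remainder below the tail of the series.\<close>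

lemma exists_signs_sum_eq:
  fixes c :: "nat \<Rightarrow> real" and r :: real
  assumes c: "\<And>n. c n \<ge> 0" "summable c" and tail: "\<And>n. c n \<le> (\<Sum>k. c (k + Suc n))" and r: "\<bar>r\<bar> \<le> (\<Sum>n. c n)"
  shows "\<exists>w. (\<forall>n. w n = 1 \<or> w n = -1) \<and> (\<lambda>n. w n * c n) sums (- r)"
proof -
  define R where "R = rec_nat r (\<lambda>n x. if x > 0 then x - c n else x + c n)"
  have R0: "R 0 = r" and RS: "R (Suc n) = (if R n > 0 then R n - c n else R n + c n)" for n
    by (simp_all add: R_def)
  define T where "T n = (\<Sum>k. c (k + n))" for n
  have TS: "T n = T (Suc n) + c n" for n
    using suminf_split_initial_segment[OF summable_ignore_initial_segment[OF c(2), of n], of 1]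
    by (simp add: T_def)
  have RT: "\<bar>R n\<bar> \<le> T n" for n
  proof (induction n)
    case 0
    show ?case using r by (simp add: R0 T_def)
  next
    case (Suc n)
    have "c n \<le> T (Suc n)" using tail[of n] by (simp add: T_def)
    thus ?case using Suc TS[of n] c(1)[of n] unfolding RS by (auto simp: abs_le_iff)
  qed
  have T0: "T \<longlonglongrightarrow> 0"
  proof (rule LIMSEQ_I)
    fix e :: real assume "e > 0"
    from suminf_exist_split[OF this c(2)] show "\<exists>no. \<forall>n\<ge>no. norm (T n - 0) < e" by (simp add: T_def)
  qed
  have "R \<longlonglongrightarrow> 0"
    by (rule Lim_null_comparison[OF _ T0]) (use RT in auto)
  define w where "w n = (if R n > 0 then -1 else 1 :: real)" for n
  have "R n = r + (\<Sum>k<n. w k * c k)" for n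
    by (induction n) (auto simp: R0 RS w_def)
  hence "(\<lambda>n. \<Sum>k<n. w k * c k) = (\<lambda>n. R n - r)" by (auto simp: fun_eq_iff)
  moreover have "(\<lambda>n. R n - r) \<longlonglongrightarrow> 0 - r" by (intro tendsto_diff \<open>R \<longlonglongrightarrow> 0\<close> tendsto_const)
  ultimately have "(\<lambda>n. w n * c n) sums (- r)" by (simp add: sums_def)
  thus ?thesis by (intro exI[of _ w]) (auto simp: w_def)
qed

section \<open>The free terms and their tails\<close>

text \<open>The bounds 8/5 and 5/3 are the ratios at n = 5 and n = 4. Under the recurrence each
  inequality at \<open>n\<close> yields the other at n + 1.\<close>

lemma fib_ratio_bounds:
  assumes "n \<ge> 4"
  shows "8 * fib n \<le> 5 * fib (Suc n)" "3 * fib (Suc n) \<le> 5 * fib n"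
proof -
  have "8 * fib n \<le> 5 * fib (Suc n) \<and> 3 * fib (Suc n) \<le> 5 * fib n" using assms
  proof (induction n rule: dec_induct)
    case base
    show ?case by (simp add: eval_nat_numeral)
  qed simp
  thus "8 * fib n \<le> 5 * fib (Suc n)" "3 * fib (Suc n) \<le> 5 * fib n" by auto
qed

text \<open>The constant is a lower approximation to (3/5)^(3/4), about 0.6817; the comparison
  reduces to 0.68^4 <= (3/5)^3.\<close>

lemma three_fifths_powr_ge:
  assumes "x \<le> 0.75"
  shows "0.68 \<le> (3 / 5 :: real) powr x"
proof -
  have "(0.68 :: real) = (0.68 ^ 4) powr (1 / 4)"
    by (simp add: powr_powr powr_realpow[symmetric] del: powr_numeral)
  also have "\<dots> \<le> ((3 / 5) ^ 3) powr (1 / 4)" by (intro powr_mono2) (simp_all add: power_divide)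
  also have "\<dots> = (3 / 5) powr 0.75" by (simp add: powr_powr powr_realpow[symmetric] del: powr_numeral)
  also have "\<dots> \<le> (3 / 5) powr x" using assms by (intro powr_mono') auto
  finally show ?thesis .
qed

lemma fib_powr_Suc_ge:
  assumes "n \<ge> 4" "0 < x" "x \<le> 0.75"
  shows "0.68 * real (fib n) powr - x \<le> real (fib (Suc n)) powr - x"
proof -
  have p: "fib n > 0" "fib (Suc n) > 0" using assms(1) by (auto intro!: fib_neq_0_nat)
  have "real (fib (Suc n)) \<le> 5 / 3 * real (fib n)" using fib_ratio_bounds(2)[OF assms(1)] by simp
  hence "(5 / 3 * real (fib n)) powr - x \<le> real (fib (Suc n)) powr - x"
    using assms p by (intro powr_mono2') auto
  moreover have "(5 / 3 * real (fib n)) powr - x = (3 / 5) powr x * real (fib n) powr - x"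
    using p by (simp add: powr_mult powr_minus powr_divide field_simps)
  moreover have "0.68 * real (fib n) powr - x \<le> (3 / 5) powr x * real (fib n) powr - x"
    using three_fifths_powr_ge[OF assms(3)] by (intro mult_right_mono) auto
  ultimately show ?thesis by simp
qed

lemma fib_powr_add_ge:
  assumes "n \<ge> 4" "0 < x" "x \<le> 0.75"
  shows "0.68 ^ k * real (fib n) powr - x \<le> real (fib (n + k)) powr - x"
proof (induction k)
  case (Suc k)
  have "0.68 ^ Suc k * real (fib n) powr - x \<le> 0.68 * real (fib (n + k)) powr - x" using Suc by (simp add: mult.commute mult.left_commute)
  also have "\<dots> \<le> real (fib (Suc (n + k))) powr - x" using assms by (intro fib_powr_Suc_ge) auto
  finally show ?case by (simp only: add_Suc_right)
qed simp

text \<open>Zero at the indices whose sign is not left to choice: 1 and 2 always have sign 1, the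
  sign at 3 is set to -1, and this forces -1 at 6 and 1 at 12. Index 4 stays free, because it enters
  the sign at 12 only through its square.\<close>

definition free_fib_term :: "real \<Rightarrow> nat \<Rightarrow> real" where
  "free_fib_term x n = (if n \<ge> 4 \<and> n \<noteq> 6 \<and> n \<noteq> 12 then real (fib n) powr - x else 0)"

lemma free_fib_term_nonneg: "free_fib_term x n \<ge> 0"
  by (simp add: free_fib_term_def)

lemma summable_free_fib_term:
  assumes "x > 0"
  shows "summable (\<lambda>n. free_fib_term x (Suc n))"
  by (rule summable_comparison_test'[OF summable_fib_powr[OF assms]]) (auto simp: free_fib_term_def)

text \<open>With q = 0.68 each term is at least q times its predecessor, and q + q^2 > 1 settles the
  generic case. If the index after next is 6 or 12, q^2 is missing and q + q^3 + q^4 > 1 is used; if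
  the next index is 6 or 12, q is missing and q^2 + q^3 + q^4 + q^5 > 1 is used.\<close>

lemma free_fib_term_le_tail:
  assumes x: "0 < x" "x \<le> 0.75"
  shows "free_fib_term x (Suc n) \<le> (\<Sum>k. free_fib_term x (Suc (k + Suc n)))"
proof (cases "Suc n \<ge> 4 \<and> Suc n \<noteq> 6 \<and> Suc n \<noteq> 12")
  case True
  define m where "m = Suc n"
  define a where "a = real (fib m) powr - x"
  have m: "m \<ge> 4" "m \<noteq> 6" "m \<noteq> 12" using True by (auto simp: m_def)
  have a: "a \<ge> 0" by (simp add: a_def)
  have sm: "summable (\<lambda>k. free_fib_term x (Suc (k + Suc n)))"
    using summable_ignore_initial_segment[OF summable_free_fib_term[OF x(1)]] .
  have part: "(\<Sum>k\<in>K. free_fib_term x (Suc (k + Suc n))) \<le> (\<Sum>k. free_fib_term x (Suc (k + Suc n)))"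
    if "finite K" for K
    using sum_le_suminf[OF sm that] free_fib_term_nonneg by simp
  have ge: "0.68 ^ Suc k * a \<le> free_fib_term x (Suc (k + Suc n))" if "m + Suc k \<noteq> 6" "m + Suc k \<noteq> 12" for k
    using fib_powr_add_ge[OF m(1) x, of "Suc k"] that m
    by (simp add: free_fib_term_def a_def m_def add.commute add.left_commute)
  have "a \<le> (\<Sum>k. free_fib_term x (Suc (k + Suc n)))"
  proof -
    consider "m = 5 \<or> m = 11" | "m = 4 \<or> m = 10" | "m \<noteq> 4" "m \<noteq> 5" "m \<noteq> 10" "m \<noteq> 11" by blast
    thus ?thesis
    proof cases
      case 1
      have "a \<le> 0.68 ^ Suc 1 * a + 0.68 ^ Suc 2 * a + 0.68 ^ Suc 3 * a + 0.68 ^ Suc 4 * a"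
        using a by (simp add: eval_nat_numeral)
      also have "\<dots> \<le> (\<Sum>k\<in>{1,2,3,4}. free_fib_term x (Suc (k + Suc n)))"
        using ge[of 1] ge[of 2] ge[of 3] ge[of 4] 1 by auto
      also have "\<dots> \<le> (\<Sum>k. free_fib_term x (Suc (k + Suc n)))" by (rule part) simp
      finally show ?thesis .
    next
      case 2
      have "a \<le> 0.68 ^ Suc 0 * a + 0.68 ^ Suc 2 * a + 0.68 ^ Suc 3 * a"
        using a by (simp add: eval_nat_numeral)
      also have "\<dots> \<le> (\<Sum>k\<in>{0,2,3}. free_fib_term x (Suc (k + Suc n)))"
        using ge[of 0] ge[of 2] ge[of 3] 2 by auto
      also have "\<dots> \<le> (\<Sum>k. free_fib_term x (Suc (k + Suc n)))" by (rule part) simp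
      finally show ?thesis .
    next
      case 3
      have "a \<le> 0.68 ^ Suc 0 * a + 0.68 ^ Suc 1 * a"
        using a by (simp add: eval_nat_numeral)
      also have "\<dots> \<le> (\<Sum>k\<in>{0,1}. free_fib_term x (Suc (k + Suc n)))"
        using ge[of 0] ge[of 1] 3 m by auto
      also have "\<dots> \<le> (\<Sum>k. free_fib_term x (Suc (k + Suc n)))" by (rule part) simp
      finally show ?thesis .
    qed
  qed
  thus ?thesis using m by (simp add: a_def free_fib_term_def m_def)
next
  case False
  hence "free_fib_term x (Suc n) = 0" by (auto simp: free_fib_term_def)
  moreover have "0 \<le> (\<Sum>k. free_fib_term x (Suc (k + Suc n)))"
    by (rule suminf_nonneg[OF summable_ignore_initial_segment[OF summable_free_fib_term[OF x(1)]] free_fib_term_nonneg])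
  ultimately show ?thesis by simp
qed

text \<open>The real Dirichlet series on the real axis, in the form in which \<open>\<sigma>\<^sub>F\<close> is the point where it equals \<open>4\<close>.\<close>

definition fib_balance :: "real \<Rightarrow> real" where
  "fib_balance x = (\<Sum>n. real (fib (Suc n)) powr - x) - 2 * 144 powr - x"

lemma suminf_fib_eq_free:
  assumes "x > 0"
  shows "(\<Sum>n. real (fib (Suc n)) powr - x)
    = 2 + 2 powr - x + 8 powr - x + 144 powr - x + (\<Sum>n. free_fib_term x (Suc n))"
proof -
  define e where "e n = (if n \<in> {0,1,2,5,11} then real (fib (Suc n)) powr - x else 0)" for n
  have eq: "(\<lambda>n. real (fib (Suc n)) powr - x) = (\<lambda>n. e n + free_fib_term x (Suc n))"
    by (rule ext) (auto simp: e_def free_fib_term_def)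
  have e: "e sums (\<Sum>n\<in>{0,1,2,5,11}. real (fib (Suc n)) powr - x)"
    unfolding e_def by (rule sums_If_finite_set) simp
  have "(\<lambda>n. e n + free_fib_term x (Suc n)) sums
     ((\<Sum>n\<in>{0,1,2,5,11}. real (fib (Suc n)) powr - x) + (\<Sum>n. free_fib_term x (Suc n)))"
    by (rule sums_add[OF e summable_sums[OF summable_free_fib_term[OF assms]]])
  thus ?thesis unfolding eq[symmetric] by (simp add: sums_iff fib_small fib_numeral_gen_fib gen_fib_numeral)
qed

text \<open>The terms with prescribed sign add up to \<open>r\<close>, and
  \<open>fib_balance x \<ge> 4\<close> says precisely that the free terms are large enough in total
  to cancel it. At equality all free signs have to be -1.\<close>

theorem exists_signs_twisted_zero:
  assumes x: "0 < x" "x \<le> 0.75" and bal: "fib_balance x \<ge> 4"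
  shows "\<exists>w. (\<forall>n. w n = 1 \<or> w n = -1) \<and> w 1 = 1 \<and> w 2 = 1 \<and> w 6 = w 3 ^ 3 \<and> w 12 = w 3 ^ 4 * w 4 ^ 2 \<and>
           twisted_fib_zeta w (of_real x) = 0"
proof -
  define r where "r = 2 + 144 powr - x - 2 powr - x - 8 powr - x"
  have le1: "2 powr - x \<le> 1" "8 powr - x \<le> 1" using powr_mono[of "- x" 0 2] powr_mono[of "- x" 0 8] x by simp_all
  have "r \<ge> 0" unfolding r_def using le1 powr_ge_zero[of 144 "- x"] by linarith
  moreover have "r \<le> (\<Sum>n. free_fib_term x (Suc n))"
    using bal suminf_fib_eq_free[OF x(1)] unfolding fib_balance_def r_def by linarith
  ultimately have "\<bar>r\<bar> \<le> (\<Sum>n. free_fib_term x (Suc n))" by simp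
  then obtain v where v: "\<And>n. v n = 1 \<or> v n = -1" "(\<lambda>n. v n * free_fib_term x (Suc n)) sums (- r)"
    using exists_signs_sum_eq[of "\<lambda>n. free_fib_term x (Suc n)" r] free_fib_term_nonneg
      summable_free_fib_term[OF x(1)] free_fib_term_le_tail[OF x] by auto
  \<comment> \<open>The argument n - 1 undoes the shift: \<open>v\<close> is indexed from 0, the
    Fibonacci indices from 1.\<close>
  define w where "w n = (if n \<in> {3, 6} then -1 else if n \<in> {1, 2, 12} then 1 else v (n - 1))" for n
  define e where "e n = (if n \<in> {0,1,2,5,11} then w (Suc n) * real (fib (Suc n)) powr - x else 0)" for n
  have e: "e sums (\<Sum>n\<in>{0,1,2,5,11}. w (Suc n) * real (fib (Suc n)) powr - x)"
    unfolding e_def by (rule sums_If_finite_set) simp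
  also have "(\<Sum>n\<in>{0,1,2,5,11}. w (Suc n) * real (fib (Suc n)) powr - x) = r"
    by (simp add: w_def r_def fib_small fib_numeral_gen_fib gen_fib_numeral)
  finally have "e sums r" .
  have eq: "(\<lambda>n. w (Suc n) * real (fib (Suc n)) powr - x) = (\<lambda>n. e n + v n * free_fib_term x (Suc n))"
    by (rule ext) (auto simp: e_def free_fib_term_def w_def)
  have "(\<lambda>n. w (Suc n) * real (fib (Suc n)) powr - x) sums (r + (- r))"
    unfolding eq by (rule sums_add[OF \<open>e sums r\<close> v(2)])
  hence "(\<lambda>n. of_real (w (Suc n) * real (fib (Suc n)) powr - x) :: complex) sums of_real 0"
    by (intro sums_of_real) simp
  moreover have "(of_real (w (Suc n) * real (fib (Suc n)) powr - x) :: complex) = of_real (w (Suc n)) * of_nat (fib (Suc n)) powr (- of_real x)" for n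
    using powr_of_real[of "real (fib (Suc n))" "- x"] by simp
  ultimately have "twisted_fib_zeta w (of_real x) = 0"
    unfolding twisted_fib_zeta_def by (simp only: sums_iff of_real_0)
  moreover have "w n = 1 \<or> w n = -1" for n using v(1)[of "n - 1"] by (auto simp: w_def)
  moreover have "w 4 ^ 2 = 1" using v(1)[of 3] by (auto simp: w_def)
  ultimately show ?thesis by (intro exI[of _ w]) (auto simp: w_def)
qed

section \<open>The abscissa \<open>\<sigma>\<^sub>F\<close>\<close>

lemma fib_zeta_of_real:
  assumes "x > 0"
  shows "fib_zeta (of_real x) = of_real (fib_balance x + 2 * 144 powr - x)"
proof -
  have "fib_zeta (of_real x) = (\<Sum>n. of_real (real (fib (Suc n)) powr - x))"
    unfolding fib_zeta_def using powr_of_real[of "real (fib (Suc _))" "- x"] by simp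
  also have "\<dots> = of_real (\<Sum>n. real (fib (Suc n)) powr - x)"
    by (rule suminf_of_real[OF summable_fib_powr[OF assms], symmetric])
  finally show ?thesis by (simp add: fib_balance_def)
qed

text \<open>Reduces a numerical bound on k^(-p/q) to an inequality between powers with natural
  exponents, which simplification decides for rational \<open>y\<close>.\<close>

lemma powr_neg_le:
  fixes k y :: real
  assumes "k > 0" "y > 0" "q > 0" "1 \<le> y ^ q * k ^ p"
  shows "k powr - (real p / real q) \<le> y"
proof -
  have "(k powr - (real p / real q)) ^ q = k powr - real p"
    using assms by (simp add: powr_realpow[symmetric] powr_powr)
  also have "\<dots> = inverse (k ^ p)" using assms by (simp add: powr_minus powr_realpow)
  also have "\<dots> \<le> y ^ q" using assms by (simp add: field_simps)
  finally have "(k powr - (real p / real q)) ^ Suc (q - 1) \<le> y ^ Suc (q - 1)" using assms(3) by simp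
  thus ?thesis using assms(2) by (rule power_le_imp_le_base[OF _ less_imp_le])
qed

lemma le_powr_neg:
  fixes k y :: real
  assumes "k > 0" "q > 0" "y ^ q * k ^ p \<le> 1"
  shows "y \<le> k powr - (real p / real q)"
proof -
  have "y ^ q \<le> inverse (k ^ p)" using assms by (simp add: field_simps)
  also have "\<dots> = k powr - real p" using assms by (simp add: powr_minus powr_realpow)
  also have "\<dots> = (k powr - (real p / real q)) ^ q"
    using assms by (simp add: powr_realpow[symmetric] powr_powr)
  finally have "y ^ Suc (q - 1) \<le> (k powr - (real p / real q)) ^ Suc (q - 1)" using assms(2) by simp
  thus ?thesis by (rule power_le_imp_le_base) simp
qed

lemma power_powr_real: "k > 0 \<Longrightarrow> (k ^ n) powr y = (k powr y) ^ n" for k y :: real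
  by (simp add: powr_powr powr_realpow[symmetric] mult.commute)

section \<open>Monotonicity of the balance\<close>

lemma powr_144: "144 powr - x = (2 powr - x) ^ 4 * (3 powr - x) ^ 2" for x :: real
proof -
  have "(144 :: real) powr - x = (2 ^ 4 * 3 ^ 2) powr - x" by simp
  also have "\<dots> = (2 ^ 4) powr - x * (3 ^ 2) powr - x" by (rule powr_mult)
  also have "\<dots> = (2 powr - x) ^ 4 * (3 powr - x) ^ 2"
    by (intro arg_cong2[where f = times] power_powr_real) simp_all
  finally show ?thesis .
qed

lemma powr_neg_2_3_le:
  fixes x :: real
  assumes "x \<ge> 0.7"
  shows "2 powr - x \<le> 0.62" "3 powr - x \<le> 0.47"
proof -
  have "2 powr - x \<le> 2 powr - (real 7 / real 10)" using assms by (intro powr_mono) auto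
  also have "\<dots> \<le> 0.62" by (rule powr_neg_le) (simp_all add: power_divide)
  finally show "2 powr - x \<le> 0.62" .
  have "3 powr - x \<le> 3 powr - (real 7 / real 10)" using assms by (intro powr_mono) auto
  also have "\<dots> \<le> 0.47" by (rule powr_neg_le) (simp_all add: power_divide)
  finally show "3 powr - x \<le> 0.47" .
qed

text \<open>With a = 2^(-x) and b = 3^(-x) the polynomial collects the contribution of 2, 3 and 144
  to the balance, where 144^(-x) = a^4 b^2 has net coefficient -1. In the stated box the increase of
  a^4 b^2 stays below that of a + b; the limits 0.62 and 0.47 are bounds for 2^(-0.7) and
  3^(-0.7).\<close>

lemma balance_polynomial_mono:
  fixes a b a' b' :: real
  assumes a: "0 \<le> a'" "a' < a" "a \<le> 0.62" and b: "0 \<le> b'" "b' \<le> b" "b \<le> 0.47"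
  shows "a' + b' - a' ^ 4 * b' ^ 2 < a + b - a ^ 4 * b ^ 2"
proof -
  have "a ^ 4 - a' ^ 4 = (a - a') * ((a + a') * (a ^ 2 + a' ^ 2))"
    by (simp add: power4_eq_xxxx power2_eq_square algebra_simps)
  also have "\<dots> \<le> (a - a') * ((0.62 + 0.62) * (0.62 ^ 2 + 0.62 ^ 2))"
    using a by (intro mult_left_mono mult_mono add_mono power_mono) auto
  also have "\<dots> \<le> (a - a') * 1" using a by (intro mult_left_mono) (auto simp: power2_eq_square)
  finally have 1: "a ^ 4 - a' ^ 4 \<le> a - a'" by simp
  have "b ^ 2 - b' ^ 2 = (b - b') * (b + b')" by (simp add: power2_eq_square algebra_simps)
  also have "\<dots> \<le> (b - b') * 1" using b by (intro mult_left_mono) auto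
  finally have 2: "b ^ 2 - b' ^ 2 \<le> b - b'" by simp
  have b2: "b ^ 2 \<le> 0.47 ^ 2" using b by (intro power_mono) auto
  have a4: "a' ^ 4 \<le> 1" using a by (intro power_le_one) auto
  have "a ^ 4 * b ^ 2 - a' ^ 4 * b' ^ 2 = (a ^ 4 - a' ^ 4) * b ^ 2 + a' ^ 4 * (b ^ 2 - b' ^ 2)"
    by (simp add: algebra_simps)
  also have "\<dots> \<le> (a - a') * 0.47 ^ 2 + 1 * (b - b')"
  proof (intro add_mono)
    show "(a ^ 4 - a' ^ 4) * b ^ 2 \<le> (a - a') * 0.47 ^ 2" using 1 a b2 by (intro mult_mono) auto
    have "a' ^ 4 * (b ^ 2 - b' ^ 2) \<le> a' ^ 4 * (b - b')" using 2 by (intro mult_left_mono) auto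
    also have "\<dots> \<le> 1 * (b - b')" using a4 b by (intro mult_right_mono) auto
    finally show "a' ^ 4 * (b ^ 2 - b' ^ 2) \<le> 1 * (b - b')" .
  qed
  also have "\<dots> < (a - a') + (b - b')" using a by (simp add: power2_eq_square)
  finally show ?thesis by simp
qed

lemma fib_balance_strict_antimono:
  assumes x: "0.7 \<le> x" "x < y"
  shows "fib_balance y < fib_balance x"
proof -
  define u where "u t n = (if n \<in> {2, 3, 11} then 0 else real (fib (Suc n)) powr - t)" for t n
  have su: "summable (u t)" if "t > 0" for t
    by (rule summable_comparison_test'[OF summable_fib_powr[OF that]]) (auto simp: u_def)
  have bal: "fib_balance t = (2 powr - t + 3 powr - t - (2 powr - t) ^ 4 * (3 powr - t) ^ 2) + (\<Sum>n. u t n)" if "t > 0" for t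
  proof -
    define e where "e n = (if n \<in> {2, 3, 11} then real (fib (Suc n)) powr - t else 0)" for n
    have e: "e sums (\<Sum>n\<in>{2,3,11}. real (fib (Suc n)) powr - t)"
      unfolding e_def by (rule sums_If_finite_set) simp
    have "(\<lambda>n. real (fib (Suc n)) powr - t) = (\<lambda>n. e n + u t n)"
      by (rule ext) (auto simp: e_def u_def)
    hence "(\<Sum>n. real (fib (Suc n)) powr - t) = (\<Sum>n\<in>{2,3,11}. real (fib (Suc n)) powr - t) + (\<Sum>n. u t n)"
      using sums_add[OF e summable_sums[OF su[OF that]]] by (simp add: sums_iff)
    also have "(\<Sum>n\<in>{2,3,11}. real (fib (Suc n)) powr - t) = 2 powr - t + 3 powr - t + 144 powr - t"
      by (simp add: fib_small fib_numeral_gen_fib gen_fib_numeral)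
    finally show ?thesis unfolding fib_balance_def powr_144[symmetric] by simp
  qed
  have pos: "x > 0" "y > 0" using x by auto
  have "(\<Sum>n. u y n) \<le> (\<Sum>n. u x n)"
  proof (rule suminf_le[OF _ su su])
    fix n show "u y n \<le> u x n" using x fib_Suc_pos[of n] by (auto simp: u_def intro!: powr_mono)
  qed (use pos in auto)
  moreover have "2 powr - y + 3 powr - y - (2 powr - y) ^ 4 * (3 powr - y) ^ 2
      < 2 powr - x + 3 powr - x - (2 powr - x) ^ 4 * (3 powr - x) ^ 2"
    using x powr_neg_2_3_le[OF x(1)] by (intro balance_polynomial_mono) (auto intro: powr_less_mono powr_mono)
  ultimately show ?thesis using bal[OF pos(1)] bal[OF pos(2)] by linarith
qed

section \<open>Location of the abscissa\<close>

lemma sum_fib_powr_initial: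
  "(\<Sum>n<12. real (fib (Suc n)) powr - x) = 2 + 2 powr - x + 3 powr - x + 5 powr - x + 8 powr - x
     + 13 powr - x + 21 powr - x + 34 powr - x + 55 powr - x + 89 powr - x + 144 powr - x"
  by (simp add: lessThan_nat_numeral lessThan_Suc fib_small fib_numeral_gen_fib gen_fib_numeral)

text \<open>Twelve terms suffice: those up to 55 give at least 4.063, and 89^(-x) - 144^(-x) is
  nonnegative. The decimals are lower bounds for k^(-0.7), hence for k^(-x).\<close>

lemma fib_balance_gt_4:
  assumes x: "0 < x" "x \<le> 0.7"
  shows "fib_balance x > 4"
proof -
  have le: "y \<le> k powr - x" if "k \<ge> 1" "y ^ 10 * k ^ 7 \<le> 1" for k y :: real
  proof -
    have "y \<le> k powr - (real 7 / real 10)" using that by (intro le_powr_neg) auto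
    also have "\<dots> \<le> k powr - x" using x that by (intro powr_mono) auto
    finally show ?thesis .
  qed
  note [simp] = power_divide
  have "615/1000 \<le> 2 powr - x" by (rule le) simp_all
  moreover have "463/1000 \<le> 3 powr - x" by (rule le) simp_all
  moreover have "324/1000 \<le> 5 powr - x" by (rule le) simp_all
  moreover have "233/1000 \<le> 8 powr - x" by (rule le) simp_all
  moreover have "166/1000 \<le> 13 powr - x" by (rule le) simp_all
  moreover have "118/1000 \<le> 21 powr - x" by (rule le) simp_all
  moreover have "84/1000 \<le> 34 powr - x" by (rule le) simp_all
  moreover have "60/1000 \<le> 55 powr - x" by (rule le) simp_all
  moreover have "144 powr - x \<le> 89 powr - x" using x by (intro powr_mono2') auto
  moreover have "(\<Sum>n<12. real (fib (Suc n)) powr - x) \<le> (\<Sum>n. real (fib (Suc n)) powr - x)"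
    by (rule sum_le_suminf[OF summable_fib_powr[OF x(1)]]) auto
  ultimately show ?thesis
    unfolding fib_balance_def sum_fib_powr_initial by linarith
qed

lemma fib_13_add_ge: "233 * (8 / 5) ^ n \<le> real (fib (n + 13))"
proof (induction n)
  case (Suc n)
  have "8 * real (fib (n + 13)) \<le> 5 * real (fib (Suc (n + 13)))"
    using fib_ratio_bounds(1)[of "n + 13"] by linarith
  thus ?case using Suc by simp
qed (simp add: fib_numeral_gen_fib gen_fib_numeral)

text \<open>The first twelve terms, less 2 * 144^(-x), give at most 3.927. From index 13 on the
  growth factor 8/5 makes the tail geometric with ratio at most 0.703 and sum at most 0.057.\<close>

lemma fib_balance_075_less_4: "fib_balance 0.75 < 4"
proof -
  define x :: real where "x = 0.75"
  have x: "x > 0" "x = real 3 / real 4" by (simp_all add: x_def)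
  note [simp] = power_divide
  have "2 powr - x \<le> 595/1000" unfolding x(2) by (rule powr_neg_le) simp_all
  moreover have "3 powr - x \<le> 439/1000" unfolding x(2) by (rule powr_neg_le) simp_all
  moreover have "5 powr - x \<le> 3/10" unfolding x(2) by (rule powr_neg_le) simp_all
  moreover have "8 powr - x \<le> 211/1000" unfolding x(2) by (rule powr_neg_le) simp_all
  moreover have "13 powr - x \<le> 147/1000" unfolding x(2) by (rule powr_neg_le) simp_all
  moreover have "21 powr - x \<le> 102/1000" unfolding x(2) by (rule powr_neg_le) simp_all
  moreover have "34 powr - x \<le> 72/1000" unfolding x(2) by (rule powr_neg_le) simp_all
  moreover have "55 powr - x \<le> 5/100" unfolding x(2) by (rule powr_neg_le) simp_all
  moreover have "89 powr - x \<le> 35/1000" unfolding x(2) by (rule powr_neg_le) simp_all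
  moreover have "24/1000 \<le> 144 powr - x" unfolding x(2) by (rule le_powr_neg) simp_all
  moreover have "(\<Sum>n. real (fib (Suc (n + 12))) powr - x) \<le> 57/1000"
  proof -
    have g: "(\<lambda>n. 0.0168 * 0.703 ^ n) sums (0.0168 * (1 / (1 - 0.703 :: real)))"
      by (intro sums_mult geometric_sums) simp
    have "(\<Sum>n. real (fib (Suc (n + 12))) powr - x) \<le> (\<Sum>n. 0.0168 * 0.703 ^ n)"
    proof (rule suminf_le[OF _ summable_ignore_initial_segment[OF summable_fib_powr[OF x(1)]] sums_summable[OF g]])
      fix n
      have "real (fib (Suc (n + 12))) powr - x \<le> (233 * (8 / 5) ^ n) powr - x"
        using fib_13_add_ge[of n] x by (intro powr_mono2') (auto simp: add.commute)
      also have "\<dots> = 233 powr - x * ((8 / 5) powr - x) ^ n"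
        by (simp add: powr_mult power_powr_real del: power_divide)
      also have "\<dots> \<le> 0.0168 * 0.703 ^ n"
      proof (intro mult_mono power_mono)
        show "233 powr - x \<le> 0.0168" unfolding x(2) by (rule powr_neg_le) simp_all
        show "(8 / 5) powr - x \<le> 0.703" unfolding x(2) by (rule powr_neg_le) simp_all
      qed auto
      finally show "real (fib (Suc (n + 12))) powr - x \<le> 0.0168 * 0.703 ^ n" .
    qed
    also have "\<dots> = 0.0168 * (1 / (1 - 0.703))" using g by (rule sums_unique[symmetric])
    also have "\<dots> \<le> 57/1000" by simp
    finally show ?thesis .
  qed
  ultimately have "fib_balance x < 4"
    using suminf_split_initial_segment[OF summable_fib_powr[OF x(1)], of 12]
    unfolding fib_balance_def sum_fib_powr_initial by linarith
  thus ?thesis by (simp add: x_def)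
qed

text \<open>Continuity is inherited from the holomorphy of the complex series.\<close>

lemma continuous_on_fib_balance: "continuous_on {0<..} fib_balance"
proof -
  have eq: "fib_balance x = Re (fib_zeta (of_real x)) - 2 * 144 powr - x" if "x \<in> {0<..}" for x
    using fib_zeta_of_real[of x] that by simp
  have "continuous_on {s. Re s > 0} fib_zeta"
    unfolding fib_zeta_eq_twisted
    by (intro holomorphic_on_imp_continuous_on twisted_fib_zeta_holomorphic) simp
  hence "continuous_on {0<..} (\<lambda>x. fib_zeta (of_real x))"
    by (rule continuous_on_compose2) (auto intro!: continuous_intros)
  hence "continuous_on {0<..} (\<lambda>x. Re (fib_zeta (of_real x)) - 2 * 144 powr - x)"
    by (intro continuous_intros) auto
  thus ?thesis by (rule continuous_on_eq) (use eq in auto)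
qed

lemma sigma_F: "0.7 < sigma_F" "sigma_F < 0.75" "fib_balance sigma_F = 4"
proof -
  have iff: "fib_zeta (of_real x) = of_real (4 + 2 * 144 powr (- x)) \<longleftrightarrow> fib_balance x = 4" if "x > 0" for x
    unfolding fib_zeta_of_real[OF that] of_real_eq_iff by auto
  have "\<exists>x\<ge>0.7. x \<le> 0.75 \<and> fib_balance x = 4"
    using fib_balance_gt_4[of "0.7"] fib_balance_075_less_4
    by (intro IVT2' continuous_on_subset[OF continuous_on_fib_balance]) auto
  then obtain x where x: "0.7 \<le> x" "x \<le> 0.75" "fib_balance x = 4" by blast
  have "fib_balance 0.7 > 4" by (rule fib_balance_gt_4) simp_all
  hence x': "0.7 < x" "x < 0.75"
    using x fib_balance_075_less_4 by (metis less_irrefl order_less_le)+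
  have "sigma_F = x"
    unfolding sigma_F_def
  proof (rule the_equality)
    show "x \<in> {0.7<..<0.75} \<and> fib_zeta (of_real x) = of_real (4 + 2 * 144 powr - x)"
      using x' iff[of x] x(3) by auto
    fix y assume y: "y \<in> {0.7<..<0.75} \<and> fib_zeta (of_real y) = of_real (4 + 2 * 144 powr - y)"
    hence "fib_balance y = 4" using iff[of y] by auto
    thus "y = x" using fib_balance_strict_antimono[of x y] fib_balance_strict_antimono[of y x] x' x(3) y
      by (cases x y rule: linorder_cases) auto
  qed
  thus "0.7 < sigma_F" "sigma_F < 0.75" "fib_balance sigma_F = 4" using x' x by simp_all
qed

lemma fib_balance_ge_4: "0 < x \<Longrightarrow> x \<le> sigma_F \<Longrightarrow> fib_balance x \<ge> 4"
  using fib_balance_gt_4[of x] fib_balance_strict_antimono[of x sigma_F] sigma_F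
  by (cases "x \<le> 0.7"; cases "x = sigma_F") auto

lemma fib_balance_le_4: "sigma_F \<le> x \<Longrightarrow> fib_balance x \<le> 4"
  using fib_balance_strict_antimono[of sigma_F x] sigma_F by (cases "x = sigma_F") auto

section \<open>The zero-free half-plane\<close>

lemma norm_plus_1_square:
  assumes "norm z = 1"
  shows "(norm (z + 1))\<^sup>2 = 2 * (Re z + 1)"
proof -
  have "(Re z)\<^sup>2 + (Im z)\<^sup>2 = 1" using cmod_power2[of z] assms by simp
  moreover have "(norm (z + 1))\<^sup>2 = (Re z + 1)\<^sup>2 + (Im z)\<^sup>2" by (simp add: cmod_power2[of "z + 1"])
  ultimately show ?thesis unfolding power2_sum by simp
qed

lemma norm_minus_1_square:
  assumes "norm z = 1"
  shows "(norm (z - 1))\<^sup>2 = 2 * (1 - Re z)"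
  using norm_plus_1_square[of "- z"] assms by (simp add: norm_minus_commute)

lemma square_sum3_le: "(p + q + 2 * r)\<^sup>2 \<le> 3 * (p\<^sup>2 + q\<^sup>2 + 4 * r\<^sup>2)" for p q r :: real
proof -
  have "0 \<le> (p - q)\<^sup>2 + (p - 2 * r)\<^sup>2 + (q - 2 * r)\<^sup>2" by simp
  thus ?thesis by (simp add: power2_eq_square algebra_simps)
qed

text \<open>For a unit vector, |v + 1|^2 is twice Re v + 1, so gains in real part are quadratic in
  the distance to -1. The decomposition of z^4 u^2 - 1 uses z^3 + 1 besides z + 1 because the term
  of F_6 = 8 also supplies a gain; squaring the resulting three-term bound gives the factor
  3.\<close>

lemma Re_phase_4_2_ge:
  fixes z u :: complex
  assumes "norm z = 1" "norm u = 1"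
  shows "1 - 3 * ((Re (z ^ 3) + 1) + (Re z + 1) + 4 * (Re u + 1)) \<le> Re (z ^ 4 * u ^ 2)"
proof -
  have "z ^ 4 * u ^ 2 - 1 = (z ^ 3 + 1) * z * u ^ 2 - (z + 1) * u ^ 2 + (u + 1) * (u - 1)"
    by (simp add: algebra_simps eval_nat_numeral)
  hence "norm (z ^ 4 * u ^ 2 - 1) \<le> norm ((z ^ 3 + 1) * z * u ^ 2) + norm ((z + 1) * u ^ 2) + norm ((u + 1) * (u - 1))"
    using norm_triangle_ineq norm_triangle_ineq4 add_mono order_trans
    by (smt (verit))
  also have "\<dots> \<le> norm (z ^ 3 + 1) + norm (z + 1) + 2 * norm (u + 1)"
  proof -
    have "norm (u - 1) \<le> 2" using norm_triangle_ineq4[of u 1] assms by simp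
    hence "norm (u + 1) * norm (u - 1) \<le> norm (u + 1) * 2" by (intro mult_left_mono) auto
    thus ?thesis using assms by (simp add: norm_mult norm_power)
  qed
  finally have "(norm (z ^ 4 * u ^ 2 - 1))\<^sup>2 \<le> (norm (z ^ 3 + 1) + norm (z + 1) + 2 * norm (u + 1))\<^sup>2"
    by (intro power_mono) auto
  also have "\<dots> \<le> 3 * ((norm (z ^ 3 + 1))\<^sup>2 + (norm (z + 1))\<^sup>2 + 4 * (norm (u + 1))\<^sup>2)" by (rule square_sum3_le)
  finally show ?thesis
    using assms by (simp add: norm_plus_1_square norm_minus_1_square norm_mult norm_power)
qed

text \<open>Otherwise t ln 2 and t ln 3 would both be odd multiples of pi, which yields a relation
  between ln 2 and ln 3 with odd, hence nonzero, integer coefficients.\<close>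

lemma fib_phase_3_4_not_both_minus_1: "\<not> (fib_phase t 3 = -1 \<and> fib_phase t 4 = -1)"
proof
  assume "fib_phase t 3 = -1 \<and> fib_phase t 4 = -1"
  hence "cos (t * ln (real (fib 3))) = -1" "cos (t * ln (real (fib 4))) = -1"
    by (auto simp: fib_phase_def complex_eq_iff)
  then obtain k l :: int where kl: "t * ln (real (fib 3)) = (2 * of_int k + 1) * pi" "t * ln (real (fib 4)) = (2 * of_int l + 1) * pi"
    unfolding cos_eq_minus1 by (auto simp: algebra_simps)
  have "t \<noteq> 0"
  proof
    assume "t = 0"
    hence "of_int (2 * k + 1) = (0 :: real)" using kl(1) by simp
    hence "2 * k + 1 = 0" by (simp only: of_int_eq_0_iff)
    thus False by presburger
  qed
  define c where "c = (\<lambda>n::nat. if n = 3 then 2 * l + 1 else - (2 * k + 1))"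
  have "t * ((2 * of_int l + 1) * ln (real (fib 3)) - (2 * of_int k + 1) * ln (real (fib 4))) = 0"
    using kl by (simp add: right_diff_distrib mult.left_commute[of t])
  hence "(2 * of_int l + 1) * ln (real (fib 3)) - (2 * of_int k + 1) * ln (real (fib 4)) = 0"
    using \<open>t \<noteq> 0\<close> by simp
  moreover have "of_int (c 3) = 2 * of_int l + (1 :: real)" "of_int (c 4) = - (2 * of_int k + (1 :: real))"
    by (simp_all add: c_def)
  ultimately have "of_int (c 3) * ln (real (fib 3)) + of_int (c 4) * ln (real (fib 4)) = 0"
    by (simp only: mult_minus_left add_uminus_conv_diff)
  hence "(\<Sum>n\<in>{3,4}. of_int (c n) * ln (real (fib n))) = 0" by simp
  hence "c 3 = 0" by (intro ln_fib_linear_independent[of "{3,4}"]) auto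
  thus False unfolding c_def by presburger
qed

text \<open>The sign pattern \<open>\<tau>\<close> gives the real part the value 4 -
  \<open>fib_balance x\<close>, nonnegative here. Departing from it can lower only the term of 144,
  and that loss is smaller than the gains at 2, 3 and 8 unless these gains vanish. A zero therefore
  forces the phases of 2 and 3 to be -1.\<close>

lemma fib_zeta_nonzero:
  assumes "Re s \<ge> sigma_F"
  shows "fib_zeta s \<noteq> 0"
proof
  assume zero: "fib_zeta s = 0"
  define x t where "x = Re s" and "t = Im s"
  have x: "x > 0.7" "fib_balance x \<le> 4" using assms sigma_F fib_balance_le_4 by (auto simp: x_def)
  have s: "s = of_real x + \<i> * of_real t" by (simp add: x_def t_def complex_eq_iff)
  define F where "F n = real (fib (Suc n)) powr - x" for n
  define z where "z n = fib_phase t (Suc n)" for n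
  define \<tau> where "\<tau> n = (if n \<in> {0, 1, 11} then 1 else -1 :: real)" for n :: nat
  have sF: "summable F" unfolding F_def using x by (intro summable_fib_powr) auto
  have F0: "F n > 0" for n using fib_Suc_pos[of n] by (simp add: F_def)
  have term_eq: "of_nat (fib (Suc n)) powr (- s) = of_real (F n) * z n" for n
    unfolding s fib_powr_shift[OF zero_less_Suc] z_def F_def
    using powr_of_real[of "real (fib (Suc n))" "- x"] by simp
  have ssum: "summable (\<lambda>n. of_real (F n) * z n)"
    using summable_twisted_term[of "\<lambda>_. 1" s] x unfolding term_eq by (simp add: x_def)
  have "(\<lambda>n. of_real (F n) * z n) sums 0"
    using summable_sums[OF ssum] zero unfolding fib_zeta_def term_eq by simp
  hence "(\<lambda>n. Re (of_real (F n) * z n)) sums Re 0" by (rule sums_Re)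
  hence Re0: "(\<lambda>n. F n * Re (z n)) sums 0" by simp
  have tau: "(\<lambda>n. F n * \<tau> n) sums (4 - fib_balance x)"
  proof -
    define e where "e n = (if n \<in> {0, 1, 11} then 2 * F n else 0)" for n
    have "e sums (\<Sum>n\<in>{0,1,11}. 2 * F n)" unfolding e_def by (rule sums_If_finite_set) simp
    also have "(\<Sum>n\<in>{0,1,11}. 2 * F n) = 4 + 2 * 144 powr - x"
      by (simp add: F_def fib_small fib_numeral_gen_fib gen_fib_numeral)
    finally have "(\<lambda>n. e n - F n) sums (4 + 2 * 144 powr - x - (\<Sum>n. F n))"
      by (intro sums_diff summable_sums sF)
    moreover have "(\<lambda>n. e n - F n) = (\<lambda>n. F n * \<tau> n)" by (rule ext) (simp add: e_def \<tau>_def)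
    ultimately show ?thesis by (simp add: fib_balance_def F_def algebra_simps)
  qed
  define g where "g n = F n * (Re (z n) - \<tau> n)" for n
  have g: "g sums (fib_balance x - 4)"
    using sums_diff[OF Re0 tau] unfolding g_def[abs_def] by (simp add: right_diff_distrib)
  have nz: "norm (z n) = 1" for n by (simp add: z_def)
  have Rez: "Re (z n) \<ge> -1" for n using abs_Re_le_cmod[of "z n"] nz[of n] by linarith
  \<comment> \<open>Positions are one less than Fibonacci indices: these are the terms of 2, 3, 8
    and 144. All other differences \<open>g n\<close> are nonnegative and may be dropped.\<close>
  have "(\<Sum>n\<in>{2,3,5,11}. g n) \<le> suminf g"
  proof (rule sum_le_suminf)
    show "summable g" using g by (rule sums_summable)
    show "0 \<le> g n" if "n \<in> - {2, 3, 5, 11}" for n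
    proof (cases "n = 0 \<or> n = 1")
      case True
      thus ?thesis by (auto simp: g_def \<tau>_def z_def fib_phase_def)
    next
      case False
      hence "\<tau> n = -1" using that by (simp add: \<tau>_def)
      thus ?thesis using Rez[of n] F0[of n] by (simp add: g_def)
    qed
  qed simp
  also have "suminf g = fib_balance x - 4" using g by (simp add: sums_iff)
  also have "\<dots> \<le> 0" using x by simp
  finally have le0: "g 2 + g 3 + g 5 + g 11 \<le> 0" by simp
  define a b where "a = 2 powr - x" and "b = 3 powr - x"
  have ab: "0 < a" "a \<le> 0.62" "0 < b" "b \<le> 0.47"
    using powr_neg_2_3_le[of x] x by (auto simp: a_def b_def)
  have Fab: "F 2 = a" "F 3 = b" "F 5 = a ^ 3" "F 11 = a ^ 4 * b ^ 2"
  proof -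
    have "8 powr - x = (2 ^ 3) powr - x" by simp
    also have "\<dots> = (2 powr - x) ^ 3" by (rule power_powr_real) simp
    finally show "F 5 = a ^ 3" by (simp add: F_def a_def fib_numeral_gen_fib gen_fib_numeral)
  qed (simp_all add: F_def a_def b_def powr_144[symmetric] fib_small fib_numeral_gen_fib gen_fib_numeral)
  define p q r where "p = Re (z 2) + 1" and "q = Re (z 3) + 1" and "r = Re (z 2 ^ 3) + 1"
  have "0 \<le> p" "0 \<le> q" using Rez[of 2] Rez[of 3] by (simp_all add: p_def q_def)
  have "0 \<le> r" using abs_Re_le_cmod[of "z 2 ^ 3"] nz[of 2] unfolding r_def norm_power by simp
  have z5: "z 5 = z 2 ^ 3" and z11: "z 11 = z 2 ^ 4 * z 3 ^ 2"
    using fib_phase_6[of t] fib_phase_12[of t] by (simp_all add: z_def)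
  have "1 - 3 * (r + p + 4 * q) \<le> Re (z 11)"
    using Re_phase_4_2_ge[of "z 2" "z 3"] nz unfolding z11 p_def q_def r_def by simp
  hence "a ^ 4 * b ^ 2 * (- 3 * (r + p + 4 * q)) \<le> a ^ 4 * b ^ 2 * (Re (z 11) - 1)"
    using ab by (intro mult_left_mono) auto
  hence "a * p + b * q + a ^ 3 * r - 3 * (a ^ 4 * b ^ 2) * (r + p + 4 * q) \<le> 0"
    using le0 by (simp add: g_def Fab \<tau>_def p_def q_def r_def z5 algebra_simps)
  hence sum0: "a * (1 - 3 * (a ^ 3 * b ^ 2)) * p + b * (1 - 12 * (a ^ 4 * b)) * q + a ^ 3 * (1 - 3 * (a * b ^ 2)) * r \<le> 0"
    by (simp add: algebra_simps power2_eq_square eval_nat_numeral)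
  have pw: "a ^ i * b ^ j \<le> 0.62 ^ i * 0.47 ^ j" for i j
    using ab by (intro mult_mono power_mono) auto
  \<comment> \<open>These keep the three coefficients positive after the loss at 144 is distributed.
    The tightest is the middle one, about 0.83, which comes from the weight 4 on
    \<open>q\<close>.\<close>
  have co: "3 * (a ^ 3 * b ^ 2) < 1" "12 * (a ^ 4 * b) < 1" "3 * (a * b ^ 2) < 1"
    using pw[of 3 2] pw[of 4 1] pw[of 1 2] by (simp_all add: power_divide)
  have "0 \<le> a ^ 3 * (1 - 3 * (a * b ^ 2)) * r" using ab co \<open>0 \<le> r\<close> by (intro mult_nonneg_nonneg) auto
  moreover have "0 \<le> a * (1 - 3 * (a ^ 3 * b ^ 2)) * p" using ab co \<open>0 \<le> p\<close> by (intro mult_nonneg_nonneg) auto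
  moreover have "0 \<le> b * (1 - 12 * (a ^ 4 * b)) * q" using ab co \<open>0 \<le> q\<close> by (intro mult_nonneg_nonneg) auto
  ultimately have "a * (1 - 3 * (a ^ 3 * b ^ 2)) * p = 0" "b * (1 - 12 * (a ^ 4 * b)) * q = 0"
    using sum0 by linarith+
  hence "p = 0" "q = 0" using ab co by auto
  hence "norm (z 2 + 1) = 0" "norm (z 3 + 1) = 0"
    using norm_plus_1_square[OF nz[of 2]] norm_plus_1_square[OF nz[of 3]] by (auto simp: p_def q_def)
  hence "fib_phase t 3 = -1 \<and> fib_phase t 4 = -1"
    by (simp add: z_def eq_neg_iff_add_eq_0)
  thus False using fib_phase_3_4_not_both_minus_1 by blast
qed

section \<open>Counting zeros\<close>

text \<open>Needed because \<open>nat\<close> sends nonpositive orders to 0. The order is positive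
  at a zero where the function does not vanish identically nearby, and the nonzero value at 2 rules
  that out on the connected half-plane.\<close>

lemma fib_zeta_zorder_pos:
  assumes "\<rho> \<in> fib_zeta_zeros"
  shows "zorder fib_zeta \<rho> > 0"
proof -
  define H where "H = {s. Re s > 0}"
  have H: "open H" "connected H" "\<rho> \<in> H" "2 \<in> H" using assms unfolding H_def
    by (simp_all add: open_halfspace_Re_gt convex_connected convex_halfspace_Re_gt fib_zeta_zeros_def)
  have hol: "fib_zeta holomorphic_on H"
    unfolding fib_zeta_eq_twisted H_def by (rule twisted_fib_zeta_holomorphic) simp
  have "fib_zeta 2 \<noteq> 0"
    unfolding fib_zeta_eq_twisted by (rule twisted_fib_zeta_2_nonzero) auto
  hence "\<forall>\<^sub>F w in at \<rho>. fib_zeta w \<noteq> 0 \<and> w \<in> H"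
    using non_zero_neighbour_alt[OF hol H(1,2,3,4)] by blast
  hence "\<exists>\<^sub>F w in at \<rho>. fib_zeta w \<noteq> 0"
    by (intro eventually_frequently) (auto elim: eventually_mono)
  thus ?thesis using zorder_pos_iff[OF hol H(1,3)] assms by (simp add: fib_zeta_zeros_def)
qed

lemma zero_count_ge_card:
  assumes "finite A" "A \<subseteq> {\<rho> \<in> fib_zeta_zeros. 0 < Im \<rho> \<and> Im \<rho> \<le> T \<and> \<bar>Re \<rho> - \<sigma>\<bar> < \<epsilon>}"
  shows "of_nat (card A) \<le> zero_count \<sigma> \<epsilon> T"
proof -
  have "(of_nat (card A) :: ennreal) = (\<Sum>\<rho>\<in>A. 1)" by simp
  also have "\<dots> \<le> (\<Sum>\<rho>\<in>A. of_nat (nat (zorder fib_zeta \<rho>)))"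
  proof (rule sum_mono)
    fix \<rho> assume "\<rho> \<in> A"
    hence "1 \<le> nat (zorder fib_zeta \<rho>)" using fib_zeta_zorder_pos[of \<rho>] assms(2) by fastforce
    hence "(of_nat 1 :: ennreal) \<le> of_nat (nat (zorder fib_zeta \<rho>))" by (rule of_nat_mono)
    thus "(1 :: ennreal) \<le> of_nat (nat (zorder fib_zeta \<rho>))" by simp
  qed
  also have "\<dots> \<le> zero_count \<sigma> \<epsilon> T"
    unfolding zero_count_def using assms
    by (subst nonneg_infsum_complete) (auto intro!: SUP_upper)
  finally show ?thesis .
qed

text \<open>The windows from kL to (k+1)L are disjoint and each contains the ordinate of one chosen
  zero, so the zeros are distinct. For T >= 2L the number of complete windows below T is at least
  T/L - 1, hence at least T/(2L).\<close>

lemma zero_count_linear_lower_bound: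
  assumes "L > 0" and zeros: "\<And>a. \<exists>\<rho>\<in>fib_zeta_zeros. Im \<rho> \<in> {a<..<a + L} \<and> \<bar>Re \<rho> - \<sigma>\<bar> < \<epsilon>"
  shows "\<exists>c>0. \<forall>\<^sub>F T in at_top. ennreal (c * T) \<le> zero_count \<sigma> \<epsilon> T"
proof -
  obtain r where r: "\<And>a. r a \<in> fib_zeta_zeros" "\<And>a. Im (r a) \<in> {a<..<a + L}" "\<And>a. \<bar>Re (r a) - \<sigma>\<bar> < \<epsilon>"
    using zeros by metis
  define z where "z k = r (real k * L)" for k :: nat
  have Imz: "real k * L < Im (z k)" "Im (z k) < real (Suc k) * L" for k
    using r(2)[of "real k * L"] by (auto simp: z_def algebra_simps)
  have "inj z"
  proof (rule injI)
    fix j k assume eq: "z j = z k"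
    have "real j * L < real (Suc k) * L" "real k * L < real (Suc j) * L"
      using Imz[of j] Imz[of k] eq by auto
    thus "j = k" using \<open>L > 0\<close> by simp
  qed
  have "ennreal (1 / (2 * L) * T) \<le> zero_count \<sigma> \<epsilon> T" if T: "T \<ge> 2 * L" for T
  proof -
    define m where "m = nat \<lfloor>T / L\<rfloor>"
    have TL: "T / L \<ge> 2" using T \<open>L > 0\<close> by (simp add: field_simps)
    have m: "real m \<le> T / L" "T / L - 1 \<le> real m" using TL by (auto simp: m_def)
    have "of_nat (card (z ` {..<m})) \<le> zero_count \<sigma> \<epsilon> T"
    proof (rule zero_count_ge_card)
      show "z ` {..<m} \<subseteq> {\<rho> \<in> fib_zeta_zeros. 0 < Im \<rho> \<and> Im \<rho> \<le> T \<and> \<bar>Re \<rho> - \<sigma>\<bar> < \<epsilon>}"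
      proof safe
        fix k assume "k < m"
        hence "real (Suc k) * L \<le> real m * L" using \<open>L > 0\<close> by (intro mult_right_mono) auto
        also have "\<dots> \<le> T" using m(1) \<open>L > 0\<close> by (simp add: field_simps)
        finally show "Im (z k) \<le> T" using Imz(2)[of k] by simp
        have "0 \<le> real k * L" using \<open>L > 0\<close> by simp
        thus "0 < Im (z k)" using Imz(1)[of k] by linarith
      qed (simp_all add: z_def r)
    qed simp
    also have "card (z ` {..<m}) = m" using \<open>inj z\<close> by (subst card_image) (auto intro: inj_on_subset)
    finally have "ennreal (real m) \<le> zero_count \<sigma> \<epsilon> T" by (simp add: ennreal_of_nat_eq_real_of_nat)
    moreover have "1 / (2 * L) * T \<le> real m" using m TL by simp
    ultimately show ?thesis using ennreal_leI order_trans by blast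
  qed
  hence "\<forall>\<^sub>F T in at_top. ennreal (1 / (2 * L) * T) \<le> zero_count \<sigma> \<epsilon> T"
    by (rule eventually_mono[OF eventually_ge_at_top[of "2 * L"]])
  thus ?thesis using \<open>L > 0\<close> by (intro exI[of _ "1 / (2 * L)"]) auto
qed

theorem theorem4p4:
  fixes \<sigma> \<epsilon> :: real
  assumes "0 < \<sigma>" and "\<sigma> \<le> sigma_F" and "0 < \<epsilon>"
  shows "(\<exists>L>0. \<forall>a::real. \<exists>\<rho>\<in>fib_zeta_zeros. Im \<rho> \<in> {a<..<a + L} \<and> \<bar>Re \<rho> - \<sigma>\<bar> < \<epsilon>)
    \<and> (\<sigma> = sigma_F \<longrightarrow>
         (\<forall>\<rho>\<in>fib_zeta_zeros. \<bar>Re \<rho> - \<sigma>\<bar> < \<epsilon> \<longrightarrow> sigma_F - \<epsilon> < Re \<rho> \<and> Re \<rho> < sigma_F))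
    \<and> (\<exists>c>0. \<forall>\<^sub>F T in at_top. ennreal (c * T) \<le> zero_count \<sigma> \<epsilon> T)"
proof -
  obtain w where w: "\<And>n. w n = 1 \<or> w n = -1" "w 1 = 1" "w 2 = 1" "w 6 = w 3 ^ 3" "w 12 = w 3 ^ 4 * w 4 ^ 2"
    "twisted_fib_zeta w (of_real \<sigma>) = 0"
    using exists_signs_twisted_zero[of \<sigma>] fib_balance_ge_4[of \<sigma>] assms sigma_F by auto
  have gaps: "\<exists>L>0. \<forall>a::real. \<exists>\<rho>\<in>fib_zeta_zeros. Im \<rho> \<in> {a<..<a + L} \<and> \<bar>Re \<rho> - \<sigma>\<bar> < \<epsilon>"
    using fib_zeta_zeros_near_twisted_zero[OF w assms(1,3)] .
  have "Re \<rho> < sigma_F" if "\<rho> \<in> fib_zeta_zeros" for \<rho>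
    using that fib_zeta_nonzero[of \<rho>] by (force simp: fib_zeta_zeros_def)
  moreover have "\<exists>c>0. \<forall>\<^sub>F T in at_top. ennreal (c * T) \<le> zero_count \<sigma> \<epsilon> T"
    using gaps zero_count_linear_lower_bound by blast
  ultimately show ?thesis using gaps by auto
qed

end
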